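(* Let $\beta\in(0,1)$ and let $(\mathsf{Z},\mathsf{A},p,c)$ be a Markov decision process such that: $\mathsf{A}$ is compact; $\mathsf{Z}$ is an infinite compact subset of $\mathbb{R}^d$ for some $d\ge1$, equipped with the Euclidean metric $d_{\mathsf{Z}}$; $c$ is a bounded continuous function on $\mathsf{Z}\times\mathsf{A}$; $p(\,\cdot\,|z,a)$ is weakly continuous in $(z,a)$; there is $K_1$ such that for all $a\in\mathsf{A}$, $c(\,\cdot\,,a)$ is Lipschitz on $\mathsf{Z}$ with constant at most $K_1$; and there is $K_2$ such that $W_1(p(\,\cdot\,|z,a),p(\,\cdot\,|y,a))\le K_2\,d_{\mathsf{Z}}(z,y)$ for all $z,y\in\mathsf{Z}$ and $a\in\mathsf{A}$. Assume $K_2\beta<1$. Let $\alpha>0$ and let $\mathsf{Z}_n\subset\mathsf{Z}$ ($n\ge1$) be finite sets with $n$ elements satisfying $\max_{z\in\mathsf{Z}}\min_{y\in\mathsf{Z}_n}d_{\mathsf{Z}}(z,y)\le\alpha(1/n)^{1/d}$ for all $n$. Let MDP$_n$ be the finite-state model on $\mathsf{Z}_n$ described in the context, $f_n^*$ an optimal deterministic stationary policy of MDP$_n$ for the $\beta$-discounted cost, and $\hat f_n=f_n^*\circ Q_n$. Then $$\|J(\hat f_n,\,\cdot\,)-J^*\|\le\frac{\tau(\beta,K_2)\,K_1\frac{1}{1-\beta K_2}+\frac{2K_1}{1-\beta}}{1-\beta}\;2\alpha\,(1/n)^{1/d},$$ where $\tau(\beta,K_2)=(2+\beta)\beta K_2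+\frac{\beta^2+4\beta+2}{(1-\beta)^2}$.
   Context: A Markov decision process (MDP) $(\mathsf{Z},\mathsf{A},p,c)$ consists of Borel spaces $\mathsf{Z}$ (states) and $\mathsf{A}$ (actions, all admissible in every state), a stochastic kernel $p(dy|z,a)$ on $\mathsf{Z}$ given $\mathsf{Z}\times\mathsf{A}$, and a measurable one-stage cost $c:\mathsf{Z}\times\mathsf{A}\to\mathbb{R}$. A policy is a sequence of stochastic kernels on $\mathsf{A}$ given the histories; $\Pi$ is the set of all policies. A deterministic stationary policy is a measurable function $f$ from states to actions, applied as $a_t=f(z_t)$. $J(\pi,z)=\mathbb{E}_z^\pi[\sum_{t\ge0}\beta^tc(z_t,a_t)]$ and $J^*(z)=\inf_{\pi\in\Pi}J(\pi,z)$. A policy is optimal if its cost equals the value function at every initial state. $\|\cdot\|$ is the sup norm. $W_1$ is the Wasserstein distance of order 1: $W_1(\mu,\xi)=\sup\{|\int g\,d\mu-\int g\,d\xi|:\ g:\mathsf{Z}\to\mathbb{R}\ \text{Lipschitz with constant}\le1\}$. Weak continuity of $p$: $p(\cdot|z_k,a_k)\to p(\cdot|z,a)$ weakly whenever $(z_k,a_k)\to(z,a)$. Finite-state models: write $\mathsf{Z}_n=\{z_{n,1},\dots,z_{n,n}\}$. $Q_n:\mathsf{Z}\to\mathsf{Z}_n$ is the nearest-neighbour map $Q_n(z)=\arg\min_{z_{n,i}}d_{\mathsf{Z}}(z,z_{n,i})$, ties broken so that $Q_n$ is measurable; $\mathcal{S}_{n,i}=\{z:Q_n(z)=z_{n,i}\}$.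 $\nu_n$ is any probability measure on $\mathsf{Z}$ with $\nu_n(\mathcal{S}_{n,i})>0$ for all $i$, and $\nu_{n,i}(\cdot)=\nu_n(\cdot)/\nu_n(\mathcal{S}_{n,i})$ on $\mathcal{S}_{n,i}$. MDP$_n$ has state space $\mathsf{Z}_n$, action space $\mathsf{A}$, one-stage cost $c_n(z_{n,i},a)=\int_{\mathcal{S}_{n,i}}c(z,a)\,\nu_{n,i}(dz)$ and transition probability $p_n(z_{n,j}|z_{n,i},a)=\int_{\mathcal{S}_{n,i}}p(\mathcal{S}_{n,j}|z,a)\,\nu_{n,i}(dz)$. *)

theory Defs
  imports "HOL-Probability.Probability"
begin

section \<open>Discounted Markov decision processes on Borel spaces\<close>

text \<open>
  States and actions form subsets of Polish types and carry the trace of the Borel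
  sigma-algebra. Only the values of \<open>transition\<close> and \<open>cost\<close> at admissible arguments matter.
\<close>

record ('z, 'a) mdp =
  states :: "'z set"
  actions :: "'a set"
  transition :: "'z \<Rightarrow> 'a \<Rightarrow> 'z measure"
  cost :: "'z \<Rightarrow> 'a \<Rightarrow> real"

definition state_space :: "('z::polish_space, 'a::polish_space) mdp \<Rightarrow> 'z measure" where
  "state_space M = restrict_space borel (states M)"

definition action_space :: "('z::polish_space, 'a::polish_space) mdp \<Rightarrow> 'a measure" where
  "action_space M = restrict_space borel (actions M)"

definition is_mdp :: "('z::polish_space, 'a::polish_space) mdp \<Rightarrow> bool" where
  "is_mdp M \<longleftrightarrow>
     states M \<in> sets borel \<and> actions M \<in> sets borel \<and>
     (\<lambda>(z, a). transition M z a) \<in>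
       state_space M \<Otimes>\<^sub>M action_space M \<rightarrow>\<^sub>M prob_algebra (state_space M) \<and>
     (\<lambda>(z, a). cost M z a) \<in> borel_measurable (state_space M \<Otimes>\<^sub>M action_space M)"

text \<open>
  A history \<open>(z\<^sub>0, a\<^sub>0, \<dots>, z\<^bsub>t-1\<^esub>, a\<^bsub>t-1\<^esub>, z\<^sub>t)\<close> up to time \<open>t\<close> is encoded as a pair \<open>(h, z\<^sub>t)\<close>
  where \<open>h i = (z\<^sub>i, a\<^sub>i)\<close> for \<open>i < t\<close>.
\<close>

type_synonym ('z, 'a) policy = "nat \<Rightarrow> (nat \<Rightarrow> 'z \<times> 'a) \<times> 'z \<Rightarrow> 'a measure"

definition history_space ::
    "('z::polish_space, 'a::polish_space) mdp \<Rightarrow> nat \<Rightarrow> ((nat \<Rightarrow> 'z \<times> 'a) \<times> 'z) measure" where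
  "history_space M t =
     (\<Pi>\<^sub>M i\<in>{0..<t}. state_space M \<Otimes>\<^sub>M action_space M) \<Otimes>\<^sub>M state_space M"

definition policies :: "('z::polish_space, 'a::polish_space) mdp \<Rightarrow> ('z, 'a) policy set" where
  "policies M = {\<pi>. \<forall>t. \<pi> t \<in> history_space M t \<rightarrow>\<^sub>M prob_algebra (action_space M)}"

definition stationary_policy ::
    "('z::polish_space, 'a::polish_space) mdp \<Rightarrow> ('z \<Rightarrow> 'a) \<Rightarrow> ('z, 'a) policy" where
  "stationary_policy M f = (\<lambda>t (h, z). return (action_space M) (f z))"

text \<open>
  Conditional law of \<open>(z\<^sub>t, a\<^sub>t)\<close> given the previous state-action pairs, and the resulting law of
  the whole trajectory (Ionescu-Tulcea) for the initial state \<open>z\<^sub>0\<close>.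
\<close>

definition step_kernel ::
    "('z::polish_space, 'a::polish_space) mdp \<Rightarrow> ('z, 'a) policy \<Rightarrow> 'z \<Rightarrow>
     nat \<Rightarrow> (nat \<Rightarrow> 'z \<times> 'a) \<Rightarrow> ('z \<times> 'a) measure" where
  "step_kernel M \<pi> z\<^sub>0 t h =
     (case t of 0 \<Rightarrow> return (state_space M) z\<^sub>0
      | Suc s \<Rightarrow> transition M (fst (h s)) (snd (h s))) \<bind>
     (\<lambda>z. distr (\<pi> t (h, z)) (state_space M \<Otimes>\<^sub>M action_space M) (\<lambda>a. (z, a)))"

lemma Ionescu_Tulcea_step_kernel:
  assumes M: "is_mdp M" and pi: "\<pi> \<in> policies M" and z: "z\<^sub>0 \<in> states M"
  shows "Ionescu_Tulcea (step_kernel M \<pi> z\<^sub>0) (\<lambda>_. state_space M \<Otimes>\<^sub>M action_space M)"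
proof -
  let ?S = "state_space M" and ?A = "action_space M"
  let ?X = "?S \<Otimes>\<^sub>M ?A"
  have p: "(\<lambda>(z, a). transition M z a) \<in> ?X \<rightarrow>\<^sub>M prob_algebra ?S"
    using M by (simp add: is_mdp_def)
  have z\<^sub>0: "z\<^sub>0 \<in> space ?S" using z by (simp add: state_space_def space_restrict_space)
  have first: "(\<lambda>h. case t of 0 \<Rightarrow> return ?S z\<^sub>0 | Suc s \<Rightarrow> transition M (fst (h s)) (snd (h s)))
      \<in> (\<Pi>\<^sub>M i\<in>{0..<t}. ?X) \<rightarrow>\<^sub>M prob_algebra ?S" for t
  proof (cases t)
    case 0
    then show ?thesis using z\<^sub>0 by (simp add: space_prob_algebra prob_space_return)
  next
    case (Suc s)
    have "(\<lambda>h. (case h s of (z,a) \<Rightarrow> transition M z a)) \<in> (\<Pi>\<^sub>M i\<in>{0..<t}. ?X) \<rightarrow>\<^sub>M prob_algebra ?S"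
      by (rule measurable_compose[OF _ p], rule measurable_component_singleton) (simp add: Suc)
    then show ?thesis by (simp add: Suc case_prod_beta)
  qed
  have second: "(\<lambda>(h, z). distr (\<pi> t (h, z)) ?X (\<lambda>a. (z, a)))
      \<in> (\<Pi>\<^sub>M i\<in>{0..<t}. ?X) \<Otimes>\<^sub>M ?S \<rightarrow>\<^sub>M prob_algebra ?X" for t
  proof -
    have "\<pi> t \<in> (\<Pi>\<^sub>M i\<in>{0..<t}. ?X) \<Otimes>\<^sub>M ?S \<rightarrow>\<^sub>M prob_algebra ?A"
      using pi by (auto simp: policies_def history_space_def)
    moreover have "(\<lambda>(x, a). (snd x, a)) \<in> ((\<Pi>\<^sub>M i\<in>{0..<t}. ?X) \<Otimes>\<^sub>M ?S) \<Otimes>\<^sub>M ?A \<rightarrow>\<^sub>M ?X"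
      by measurable
    ultimately have "(\<lambda>x. distr (\<pi> t x) ?X (\<lambda>a. (snd x, a)))
        \<in> (\<Pi>\<^sub>M i\<in>{0..<t}. ?X) \<Otimes>\<^sub>M ?S \<rightarrow>\<^sub>M prob_algebra ?X"
      by (rule measurable_distr_prob_space2)
    also have "(\<lambda>x. distr (\<pi> t x) ?X (\<lambda>a. (snd x, a))) = (\<lambda>(h, z). distr (\<pi> t (h, z)) ?X (\<lambda>a. (z, a)))"
      by (auto simp: fun_eq_iff)
    finally show ?thesis .
  qed
  have k: "step_kernel M \<pi> z\<^sub>0 t \<in> (\<Pi>\<^sub>M i\<in>{0..<t}. ?X) \<rightarrow>\<^sub>M prob_algebra ?X" for t
    unfolding step_kernel_def
    by (rule measurable_bind_prob_space2[OF first second])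
  show ?thesis
  proof (rule Ionescu_Tulcea.intro)
    fix i h
    show "step_kernel M \<pi> z\<^sub>0 i \<in> (\<Pi>\<^sub>M i\<in>{0..<i}. ?X) \<rightarrow>\<^sub>M subprob_algebra ?X"
      using k by (rule measurable_prob_algebraD)
    assume "h \<in> space (\<Pi>\<^sub>M i\<in>{0..<i}. ?X)"
    from measurable_space[OF k this] show "prob_space (step_kernel M \<pi> z\<^sub>0 i h)"
      by (simp add: space_prob_algebra)
  qed
qed

definition trajectory_law ::
    "('z::polish_space, 'a::polish_space) mdp \<Rightarrow> ('z, 'a) policy \<Rightarrow> 'z \<Rightarrow>
     (nat \<Rightarrow> 'z \<times> 'a) measure" where
  "trajectory_law M \<pi> z\<^sub>0 =
     projective_family.lim UNIV
       (Ionescu_Tulcea.CI (step_kernel M \<pi> z\<^sub>0) (\<lambda>_. state_space M \<Otimes>\<^sub>M action_space M))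
       (\<lambda>_. state_space M \<Otimes>\<^sub>M action_space M)"

definition discounted_cost ::
    "('z::polish_space, 'a::polish_space) mdp \<Rightarrow> real \<Rightarrow> ('z, 'a) policy \<Rightarrow> 'z \<Rightarrow> real" where
  "discounted_cost M \<beta> \<pi> z =
     (LINT \<omega>|trajectory_law M \<pi> z. (\<Sum>t. \<beta> ^ t * cost M (fst (\<omega> t)) (snd (\<omega> t))))"

text \<open>
  The infimum is taken in the reals, so it is meaningful only when the discounted costs are
  bounded below, for instance for bounded \<open>cost\<close> and \<open>0 < \<beta> < 1\<close>.
\<close>

definition value_function ::
    "('z::polish_space, 'a::polish_space) mdp \<Rightarrow> real \<Rightarrow> 'z \<Rightarrow> real" where
  "value_function M \<beta> z = (INF \<pi>\<in>policies M. discounted_cost M \<beta> \<pi> z)"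

definition optimal_policy ::
    "('z::polish_space, 'a::polish_space) mdp \<Rightarrow> real \<Rightarrow> ('z, 'a) policy \<Rightarrow> bool" where
  "optimal_policy M \<beta> \<pi> \<longleftrightarrow>
     \<pi> \<in> policies M \<and> (\<forall>z\<in>states M. discounted_cost M \<beta> \<pi> z = value_function M \<beta> z)"

definition optimal_stationary ::
    "('z::polish_space, 'a::polish_space) mdp \<Rightarrow> real \<Rightarrow> ('z \<Rightarrow> 'a) \<Rightarrow> bool" where
  "optimal_stationary M \<beta> f \<longleftrightarrow>
     f \<in> state_space M \<rightarrow>\<^sub>M action_space M \<and> optimal_policy M \<beta> (stationary_policy M f)"

section \<open>Weak convergence and the Wasserstein distance of order 1\<close>

definition weakly_converges ::
    "'z::topological_space set \<Rightarrow> (nat \<Rightarrow> 'z measure) \<Rightarrow> 'z measure \<Rightarrow> bool" where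
  "weakly_converges Z \<mu>s \<mu> \<longleftrightarrow>
     (\<forall>g :: 'z \<Rightarrow> real. continuous_on Z g \<and> bounded (g ` Z) \<longrightarrow>
        (\<lambda>k. LINT z|\<mu>s k. g z) \<longlonglongrightarrow> (LINT z|\<mu>. g z))"

definition weakly_continuous_kernel ::
    "('z::polish_space, 'a::polish_space) mdp \<Rightarrow> bool" where
  "weakly_continuous_kernel M \<longleftrightarrow>
     (\<forall>zs as. \<forall>z\<in>states M. \<forall>a\<in>actions M.
        (\<forall>k. zs k \<in> states M \<and> as k \<in> actions M) \<and> (\<lambda>k. (zs k, as k)) \<longlonglongrightarrow> (z, a) \<longrightarrow>
        weakly_converges (states M) (\<lambda>k. transition M (zs k) (as k)) (transition M z a))"

definition wasserstein1 :: "'z::metric_space set \<Rightarrow> 'z measure \<Rightarrow> 'z measure \<Rightarrow> ereal" where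
  "wasserstein1 Z \<mu> \<xi> =
     (SUP g\<in>{g :: 'z \<Rightarrow> real. 1-lipschitz_on Z g}.
        ereal \<bar>(LINT z|\<mu>. g z) - (LINT z|\<xi>. g z)\<bar>)"

section \<open>Finite-state models\<close>

definition nearest_neighbour_map ::
    "'z::metric_space set \<Rightarrow> 'z set \<Rightarrow> ('z \<Rightarrow> 'z) \<Rightarrow> bool" where
  "nearest_neighbour_map Z Y Q \<longleftrightarrow>
     Q \<in> restrict_space borel Z \<rightarrow>\<^sub>M restrict_space borel Y \<and>
     (\<forall>z\<in>Z. is_arg_min (dist z) (\<lambda>y. y \<in> Y) (Q z))"

definition cell :: "'z set \<Rightarrow> ('z \<Rightarrow> 'z) \<Rightarrow> 'z \<Rightarrow> 'z set" where
  "cell Z Q y = {z \<in> Z. Q z = y}"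

text \<open>
  The points of \<open>Y\<close> themselves serve as indices of the cells. The conditional distribution
  \<open>\<nu>(\<cdot>)/\<nu>(cell)\<close> is \<^const>\<open>uniform_measure\<close>, kept as a measure on all of the state space and
  integrated over the cell.
\<close>

definition finite_model ::
    "('z::polish_space, 'a::polish_space) mdp \<Rightarrow> 'z set \<Rightarrow> ('z \<Rightarrow> 'z) \<Rightarrow> 'z measure \<Rightarrow>
     ('z, 'a) mdp" where
  "finite_model M Y Q \<nu> =
     \<lparr> states = Y,
       actions = actions M,
       transition = (\<lambda>x a. point_measure Y (\<lambda>y.
         \<integral>\<^sup>+z\<in>cell (states M) Q x. emeasure (transition M z a) (cell (states M) Q y)
           \<partial>uniform_measure \<nu> (cell (states M) Q x))),
       cost = (\<lambda>x a.
         LINT z:cell (states M) Q x|uniform_measure \<nu> (cell (states M) Q x). cost M z a) \<rparr>"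

definition tau :: "real \<Rightarrow> real \<Rightarrow> real" where
  "tau \<beta> K = (2 + \<beta>) * \<beta> * K + (\<beta>\<^sup>2 + 4 * \<beta> + 2) / (1 - \<beta>)\<^sup>2"

end

theory Submission
  imports Defs
begin

text \<open>
  Let \<open>v\<close> be the fixed point of the Bellman operator; it is Lipschitz with constant
  \<open>L = K\<^sub>1 / (1 - \<beta> K\<^sub>2)\<close>, because the operator preserves that constant. Telescoping the
  expectations of \<open>v\<close> along a trajectory gives \<open>v \<le> J\<close> for every policy, hence \<open>v\<close> is a lower bound
  of the value function. The reverse inequality is not needed, so no measurable selection enters:
  near-optimal actions are chosen on the finite state space only. Averaging over a cell of diameter
  at most \<open>2 \<epsilon>\<close> perturbs a Bellman update of \<open>v\<close> by at most \<open>2 L \<epsilon>\<close>, so the value function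
  of the finite model, extended by \<open>Q\<close>, is within \<open>2 L \<epsilon> / (1 - \<beta>)\<close> of \<open>v\<close>. Consequently one
  step with the extended policy exceeds \<open>v\<close> by at most \<open>4 L \<epsilon> / (1 - \<beta>)\<close>, and its discounted
  cost by at most \<open>4 L \<epsilon> / (1 - \<beta>)\<^sup>2\<close>, which is smaller than the claimed bound.
\<close>

section \<open>Kernels and the trajectory measure\<close>

text \<open>Two function classes carry the argument. An infimum over an uncountable action set need
  not preserve measurability, so the Bellman operator acts on \<open>L\<close>-Lipschitz functions:
  these are continuous, and the class survives both such infima and pointwise limits. The cost
  \<open>u \<circ> Q\<close> of the finite model may jump between cells and is merely bounded and
  measurable. Every move of the state inside a cell is therefore charged to \<open>v\<close>, where
  it costs \<open>L\<close> times the distance, and exchanging \<open>u \<circ> Q\<close> for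
  \<open>v\<close> under a transition integral costs \<open>\<beta>\<close> times their uniform gap.
  The factor 4 comes from two one-sided gaps between \<open>v\<close> and
  \<open>u \<circ> Q\<close>, each of size \<open>2 * L * \<epsilon> / (1 - \<beta>)\<close>. One
  power of \<open>1 - \<beta>\<close> solves the recursion for the gap, the other sums the loss per
  step over time. Policies may depend on the whole history, but only one-time expectations enter:
  the expectation of \<open>v\<close> at time \<open>t + 1\<close> is that of its transition
  integral at time \<open>t\<close>.\<close>

lemma prob_algebra_integral_bound:
  fixes f :: "'a \<Rightarrow> real"
  assumes A: "A \<in> space (prob_algebra N)" and f: "f \<in> borel_measurable N"
    and B: "\<And>x. x \<in> space N \<Longrightarrow> \<bar>f x\<bar> \<le> B"
  shows "integrable A f" "\<bar>LINT x|A. f x\<bar> \<le> B"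
proof -
  interpret prob_space A using A by (simp add: space_prob_algebra)
  have sets: "sets A = sets N" using A by (simp add: space_prob_algebra)
  note [measurable_cong] = sets
  have sp: "space A = space N" by (rule sets_eq_imp_space_eq[OF sets])
  show i: "integrable A f"
    by (rule integrable_const_bound[of _ B]) (use f B sp in auto)
  have "\<bar>LINT x|A. f x\<bar> \<le> (LINT x|A. \<bar>f x\<bar>)" by (rule integral_abs_bound)
  also have "\<dots> \<le> B"
    by (rule integral_le_const) (use i B sp in auto)
  finally show "\<bar>LINT x|A. f x\<bar> \<le> B" .
qed

lemma integral_bind_prob_algebra:
  fixes f :: "'b \<Rightarrow> real"
  assumes A: "A \<in> space (prob_algebra N)" and K: "K \<in> N \<rightarrow>\<^sub>M prob_algebra L"
    and f: "f \<in> borel_measurable L" and B: "\<And>x. x \<in> space L \<Longrightarrow> \<bar>f x\<bar> \<le> B"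
  shows "(LINT y|(A \<bind> K). f y) = (LINT x|A. LINT y|K x. f y)"
proof -
  have sets: "sets A = sets N" and fin: "finite_measure A"
    using A by (auto simp: space_prob_algebra prob_space_def)
  have K': "K \<in> A \<rightarrow>\<^sub>M subprob_algebra L"
    using measurable_prob_algebraD[OF K] by (simp cong: measurable_cong_sets add: sets)
  have bd: "AE x in A. emeasure (K x) (space (K x)) \<le> ennreal 1"
  proof (rule AE_I2)
    fix x assume "x \<in> space A"
    then have "subprob_space (K x)" by (rule subprob_space_kernel[OF K'])
    then show "emeasure (K x) (space (K x)) \<le> ennreal 1"
      by (simp add: subprob_space.emeasure_space_le_1)
  qed
  show ?thesis by (rule integral_bind[OF f B K' fin bd])
qed

lemma kernel_integral_measurable:
  fixes f :: "'b \<Rightarrow> real"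
  assumes "K \<in> N \<rightarrow>\<^sub>M prob_algebra L" "f \<in> borel_measurable L"
  shows "(\<lambda>x. LINT y|K x. f y) \<in> borel_measurable N"
  by (rule measurable_compose[OF measurable_prob_algebraD[OF assms(1)] integral_measurable_subprob_algebra[OF assms(2)]])

text \<open>Here the integrand depends on the parameter as well. Pushing \<open>K x\<close> forward
  along \<open>y \<mapsto> (x, y)\<close> gives a kernel into the product, against which the
  integrand is fixed.\<close>

lemma kernel_integral_measurable2:
  fixes f :: "'a \<times> 'b \<Rightarrow> real"
  assumes f: "f \<in> borel_measurable (N \<Otimes>\<^sub>M L)" and K: "K \<in> N \<rightarrow>\<^sub>M prob_algebra L"
  shows "(\<lambda>x. LINT y|K x. f (x, y)) \<in> borel_measurable N"
proof -
  have "(\<lambda>x. distr (K x) (N \<Otimes>\<^sub>M L) (\<lambda>y. (x, y))) \<in> N \<rightarrow>\<^sub>M prob_algebra (N \<Otimes>\<^sub>M L)"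
    by (rule measurable_distr_prob_space2[OF K]) simp
  from kernel_integral_measurable[OF this f]
  have "(\<lambda>x. LINT p|distr (K x) (N \<Otimes>\<^sub>M L) (\<lambda>y. (x, y)). f p) \<in> borel_measurable N" .
  also have "?this \<longleftrightarrow> (\<lambda>x. LINT y|K x. f (x, y)) \<in> borel_measurable N"
  proof (rule measurable_cong)
    fix x assume x: "x \<in> space N"
    then have sets: "sets (K x) = sets L"
      using measurable_space[OF K] by (simp add: space_prob_algebra)
    have "Pair x \<in> K x \<rightarrow>\<^sub>M N \<Otimes>\<^sub>M L"
      using measurable_Pair1'[OF x] by (simp only: measurable_cong_sets[OF sets refl])
    then show "(LINT p|distr (K x) (N \<Otimes>\<^sub>M L) (\<lambda>y. (x, y)). f p) = (LINT y|K x. f (x, y))"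
      by (rule integral_distr[OF _ f])
  qed
  finally show ?thesis .
qed

section \<open>One-time marginals of the Ionescu-Tulcea measure\<close>

context Ionescu_Tulcea
begin

text \<open>The cylinder over the empty index set is the whole space, so the total mass of the limit
  is that of \<open>CI {}\<close>.\<close>

lemma prob_space_lim: "prob_space PF.lim"
proof
  have "emeasure PF.lim (PF.emb UNIV {} (space (PiM {} M))) = emeasure (CI {}) (space (PiM {} M))"
    by (rule lim) auto
  moreover have "PF.emb UNIV {} (space (PiM {} M)) = space PF.lim"
    by (simp add: prod_emb_def)
       (auto simp: space_PiM)
  moreover have "emeasure (CI {}) (space (CI {})) = 1"
    by (rule prob_space.emeasure_space_1[OF PF.prob_space_P]) auto
  moreover have "space (CI {}) = space (PiM {} M)" by (simp add: CI_def)
  ultimately show "emeasure PF.lim (space PF.lim) = 1" by simp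
qed

text \<open>For an initial segment the cylinder embedding is the identity. The start
  \<open>\<lambda>_. undefined\<close> is the only point of the product over the empty index set,
  that is, the empty history.\<close>

lemma CI_lessThan: "CI {0..<n} = C 0 n (\<lambda>_. undefined)"
proof (rule measure_eqI)
  fix X assume "X \<in> sets (CI {0..<n})"
  then have X: "X \<in> sets (PiM {0..<n} M)" by (simp add: CI_def)
  have "PF.emb {0..<n} {0..<n} X = X"
    using sets.sets_into_space[OF X] by (auto simp: prod_emb_def space_PiM PiE_restrict)
  then show "emeasure (CI {0..<n}) X = emeasure (C 0 n (\<lambda>_. undefined)) X"
    using emeasure_CI[OF order_refl X] by simp
qed (simp add: CI_def sets_C space_PiM)

text \<open>The marginal on the first \<open>n + 1\<close> coordinates extends the first
  \<open>n\<close> by a sample from \<open>P n\<close>; projecting to coordinate \<open>n\<close>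
  keeps that sample and integrates out the history.\<close>

lemma distr_lim_component:
  "distr PF.lim (M n) (\<lambda>\<omega>. \<omega> n) = distr PF.lim (PiM {0..<n} M) (\<lambda>\<omega>. restrict \<omega> {0..<n}) \<bind> P n"
proof -
  have "distr PF.lim (M n) (\<lambda>\<omega>. \<omega> n) =
      distr (distr PF.lim (PiM {0..<Suc n} M) (\<lambda>\<omega>. restrict \<omega> {0..<Suc n})) (M n) (\<lambda>\<omega>. \<omega> n)"
    by (subst distr_distr) (auto simp: comp_def measurable_cong_sets[OF PF.sets_lim refl] intro!: measurable_restrict measurable_component_singleton)
  also have "\<dots> = distr (C 0 n (\<lambda>_. undefined) \<bind> eP n) (M n) (\<lambda>\<omega>. \<omega> n)"
    by (subst distr_lim) (simp_all add: CI_lessThan del: atLeastLessThan_iff)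
  also have "\<dots> = C 0 n (\<lambda>_. undefined) \<bind> P n"
  proof (rule measure_eqI)
    have und: "(\<lambda>_. undefined) \<in> space (PiM {0..<0} M)" by (simp add: space_PiM)
    have ne: "space (C 0 n (\<lambda>_. undefined)) \<noteq> {}"
      using prob_space_C[OF und] by (rule prob_space.not_empty)
    have sC: "sets (C 0 n (\<lambda>_. undefined)) = sets (PiM {0..<n} M)" using sets_C[OF und] by simp
    have spC: "space (C 0 n (\<lambda>_. undefined)) = space (PiM {0..<n} M)" using space_C[OF und] by simp
    have P': "P n \<in> C 0 n (\<lambda>_. undefined) \<rightarrow>\<^sub>M subprob_algebra (M n)"
      using P[of n] by (simp cong: measurable_cong_sets add: sC)
    have eP': "eP n \<in> C 0 n (\<lambda>_. undefined) \<rightarrow>\<^sub>M subprob_algebra (PiM {0..<Suc n} M)"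
      using measurable_eP[of n] by (simp cong: measurable_cong_sets add: sC)
    have sb: "sets (C 0 n (\<lambda>_. undefined) \<bind> P n) = sets (M n)"
      by (rule sets_bind_measurable[OF P' ne])
    show "sets (distr (C 0 n (\<lambda>_. undefined) \<bind> eP n) (M n) (\<lambda>\<omega>. \<omega> n)) = sets (C 0 n (\<lambda>_. undefined) \<bind> P n)"
      by (simp add: sb)
    fix A assume "A \<in> sets (distr (C 0 n (\<lambda>_. undefined) \<bind> eP n) (M n) (\<lambda>\<omega>. \<omega> n))"
    then have A[measurable]: "A \<in> sets (M n)" by simp
    have comp: "(\<lambda>\<omega>. \<omega> n) \<in> PiM {0..<Suc n} M \<rightarrow>\<^sub>M M n"
      by (rule measurable_component_singleton) simp
    have sE: "sets (C 0 n (\<lambda>_. undefined) \<bind> eP n) = sets (PiM {0..<Suc n} M)"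
      by (rule sets_bind_measurable[OF eP' ne])
    have comp': "(\<lambda>\<omega>. \<omega> n) \<in> (C 0 n (\<lambda>_. undefined) \<bind> eP n) \<rightarrow>\<^sub>M M n"
      using comp by (simp cong: measurable_cong_sets add: sE)
    let ?X = "(\<lambda>\<omega>. \<omega> n) -` A \<inter> space (PiM {0..<Suc n} M)"
    have X: "?X \<in> sets (PiM {0..<Suc n} M)" by (rule measurable_sets[OF comp A])
    have "emeasure (distr (C 0 n (\<lambda>_. undefined) \<bind> eP n) (M n) (\<lambda>\<omega>. \<omega> n)) A
        = emeasure (C 0 n (\<lambda>_. undefined) \<bind> eP n) ?X"
      by (subst emeasure_distr[OF comp' A]) (simp add: sets_eq_imp_space_eq[OF sE])
    also have "\<dots> = (\<integral>\<^sup>+\<omega>. emeasure (eP n \<omega>) ?X \<partial>C 0 n (\<lambda>_. undefined))"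
      by (rule emeasure_bind[OF ne eP' X])
    also have "\<dots> = (\<integral>\<^sup>+\<omega>. emeasure (P n \<omega>) A \<partial>C 0 n (\<lambda>_. undefined))"
    proof (rule nn_integral_cong)
      fix \<omega> assume "\<omega> \<in> space (C 0 n (\<lambda>_. undefined))"
      then have w: "\<omega> \<in> space (PiM {0..<n} M)" by (simp add: spC)
      \<comment> \<open>\<open>?X\<close> constrains only the coordinate that \<open>eP n\<close>
        appends, so its preimage under the extension map is \<open>A\<close> itself.\<close>
      have "(\<lambda>x. fun_upd \<omega> n x) -` ?X \<inter> space (M n) = A"
        using w sets.sets_into_space[OF A]
        by (auto simp: space_PiM PiE_iff extensional_def)
      then show "emeasure (eP n \<omega>) ?X = emeasure (P n \<omega>) A"
        by (simp add: emeasure_eP[OF w X])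
    qed
    also have "\<dots> = emeasure (C 0 n (\<lambda>_. undefined) \<bind> P n) A"
      by (rule emeasure_bind[OF ne P' A, symmetric])
    finally show "emeasure (distr (C 0 n (\<lambda>_. undefined) \<bind> eP n) (M n) (\<lambda>\<omega>. \<omega> n)) A
        = emeasure (C 0 n (\<lambda>_. undefined) \<bind> P n) A" .
  qed
  also have "C 0 n (\<lambda>_. undefined) = distr PF.lim (PiM {0..<n} M) (\<lambda>\<omega>. restrict \<omega> {0..<n})"
    by (subst distr_lim) (simp_all add: CI_lessThan)
  finally show ?thesis .
qed

text \<open>All later estimates reach the dynamics of the trajectory measure through this
  identity.\<close>

lemma integral_lim_component:
  fixes g :: "'a \<Rightarrow> real"
  assumes g: "g \<in> borel_measurable (M n)" and B: "\<And>x. x \<in> space (M n) \<Longrightarrow> \<bar>g x\<bar> \<le> B"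
  shows "(LINT \<omega>|PF.lim. g (\<omega> n)) = (LINT \<omega>|PF.lim. LINT x|P n (restrict \<omega> {0..<n}). g x)"
proof -
  have r: "(\<lambda>\<omega>. restrict \<omega> {0..<n}) \<in> PF.lim \<rightarrow>\<^sub>M PiM {0..<n} M"
    by (auto simp: measurable_cong_sets[OF PF.sets_lim refl] intro!: measurable_restrict_subset)
  have c: "(\<lambda>\<omega>. \<omega> n) \<in> PF.lim \<rightarrow>\<^sub>M M n"
    by (simp add: measurable_cong_sets[OF PF.sets_lim refl] measurable_component_singleton)
  have P': "P n \<in> PiM {0..<n} M \<rightarrow>\<^sub>M prob_algebra (M n)"
    by (rule measurable_prob_algebraI[OF prob_space_P P])
  have d: "distr PF.lim (PiM {0..<n} M) (\<lambda>\<omega>. restrict \<omega> {0..<n}) \<in> space (prob_algebra (PiM {0..<n} M))"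
    by (simp add: space_prob_algebra prob_space.prob_space_distr[OF prob_space_lim r])
  have "(LINT \<omega>|PF.lim. g (\<omega> n)) = (LINT x|distr PF.lim (M n) (\<lambda>\<omega>. \<omega> n). g x)"
    by (rule integral_distr[OF c g, symmetric])
  also have "\<dots> = (LINT h|distr PF.lim (PiM {0..<n} M) (\<lambda>\<omega>. restrict \<omega> {0..<n}). LINT x|P n h. g x)"
    unfolding distr_lim_component by (rule integral_bind_prob_algebra[OF d P' g B])
  also have "\<dots> = (LINT \<omega>|PF.lim. LINT x|P n (restrict \<omega> {0..<n}). g x)"
    by (rule integral_distr[OF r]) (rule kernel_integral_measurable[OF P' g])
  finally show ?thesis .
qed

end

section \<open>Verification of bounds on the discounted cost\<close>

text \<open>Weighted by \<open>\<beta> ^ t\<close>, the \<open>e\<close> terms of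
  \<open>step\<close> telescope. The boundary term vanishes because \<open>e\<close> is bounded, and
  the slack sums to a geometric series.\<close>

lemma discounted_sum_le:
  fixes c e :: "nat \<Rightarrow> real"
  assumes \<beta>: "0 \<le> \<beta>" "\<beta> < 1" and e: "\<And>t. \<bar>e t\<bar> \<le> b"
    and step: "\<And>t. c t + \<beta> * e (Suc t) \<le> e t + \<delta>"
    and J: "(\<lambda>t. \<beta> ^ t * c t) sums J"
  shows "J \<le> e 0 + \<delta> / (1 - \<beta>)"
proof -
  have "(\<lambda>t. \<beta> ^ t * e t) \<longlonglongrightarrow> 0"
  proof (rule Lim_null_comparison)
    show "\<forall>\<^sub>F t in sequentially. norm (\<beta> ^ t * e t) \<le> b * \<beta> ^ t"
      using e \<beta> by (auto simp: abs_mult mult.commute intro!: mult_right_mono always_eventually)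
    show "(\<lambda>t. b * \<beta> ^ t) \<longlonglongrightarrow> 0"
      using \<beta> by (auto intro!: tendsto_mult_right_zero LIMSEQ_realpow_zero)
  qed
  from telescope_sums'[OF this] have 1: "(\<lambda>t. \<beta> ^ t * e t - \<beta> ^ Suc t * e (Suc t)) sums e 0"
    by simp
  have 2: "(\<lambda>t. \<delta> * \<beta> ^ t) sums (\<delta> * (1 / (1 - \<beta>)))"
    using \<beta> by (intro sums_mult geometric_sums) auto
  have "J \<le> e 0 + \<delta> * (1 / (1 - \<beta>))"
  proof (rule sums_le[OF _ J sums_add[OF 1 2]])
    fix t
    have "\<beta> ^ t * (c t) \<le> \<beta> ^ t * (e t - \<beta> * e (Suc t) + \<delta>)"
      using step[of t] \<beta> by (intro mult_left_mono) auto
    then show "\<beta> ^ t * c t \<le> \<beta> ^ t * e t - \<beta> ^ Suc t * e (Suc t) + \<delta> * \<beta> ^ t"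
      by (simp add: algebra_simps)
  qed
  then show ?thesis by simp
qed

text \<open>\<open>B\<close> is a parameter so that the finite model can be shown to satisfy the
  same bound.\<close>

locale bounded_mdp =
  fixes M :: "('z::polish_space, 'a::polish_space) mdp" and B :: real
  assumes mdp: "is_mdp M"
    and cost_bound: "\<And>z a. z \<in> states M \<Longrightarrow> a \<in> actions M \<Longrightarrow> \<bar>cost M z a\<bar> \<le> B"
begin

abbreviation "S \<equiv> state_space M"
abbreviation "A \<equiv> action_space M"

lemma space_S [simp]: "space S = states M"
  by (simp add: state_space_def space_restrict_space)

lemma space_A [simp]: "space A = actions M"
  by (simp add: action_space_def space_restrict_space)

lemma transition_measurable:
  "(\<lambda>x. transition M (fst x) (snd x)) \<in> S \<Otimes>\<^sub>M A \<rightarrow>\<^sub>M prob_algebra S"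
  using mdp by (simp add: is_mdp_def case_prod_beta')

lemma cost_measurable [measurable]:
  "(\<lambda>x. cost M (fst x) (snd x)) \<in> borel_measurable (S \<Otimes>\<^sub>M A)"
  using mdp by (simp add: is_mdp_def case_prod_beta')

lemma transition_prob_algebra:
  "z \<in> states M \<Longrightarrow> a \<in> actions M \<Longrightarrow> transition M z a \<in> space (prob_algebra S)"
  using measurable_space[OF transition_measurable, of "(z, a)"] by (simp add: space_pair_measure)

section \<open>Expectations along the trajectories of a fixed policy\<close>

context
  fixes \<pi> :: "('z, 'a) policy" and z\<^sub>0 :: 'z
  assumes pi: "\<pi> \<in> policies M" and z\<^sub>0: "z\<^sub>0 \<in> states M"
begin

interpretation IT: Ionescu_Tulcea "step_kernel M \<pi> z\<^sub>0" "\<lambda>_. S \<Otimes>\<^sub>M A"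
  by (rule Ionescu_Tulcea_step_kernel[OF mdp pi z\<^sub>0])

abbreviation "law \<equiv> trajectory_law M \<pi> z\<^sub>0"

lemma law_prob_algebra: "law \<in> space (prob_algebra (PiM UNIV (\<lambda>_. S \<Otimes>\<^sub>M A)))"
  using IT.prob_space_lim by (simp add: trajectory_law_def space_prob_algebra)

lemma space_law: "space law = (UNIV \<rightarrow>\<^sub>E states M \<times> actions M)"
  by (simp add: trajectory_law_def space_PiM space_pair_measure)

lemma integral_law_component:
  fixes g :: "'z \<times> 'a \<Rightarrow> real"
  assumes g: "g \<in> borel_measurable (S \<Otimes>\<^sub>M A)"
    and b: "\<And>z a. z \<in> states M \<Longrightarrow> a \<in> actions M \<Longrightarrow> \<bar>g (z, a)\<bar> \<le> b"
  shows "integrable law (\<lambda>\<omega>. g (\<omega> t))" "\<bar>LINT \<omega>|law. g (\<omega> t)\<bar> \<le> b"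
proof -
  have m: "(\<lambda>\<omega>. g (\<omega> t)) \<in> borel_measurable (PiM UNIV (\<lambda>_. S \<Otimes>\<^sub>M A))"
    using g by measurable
  have bd: "\<bar>g (\<omega> t)\<bar> \<le> b" if "\<omega> \<in> space (PiM UNIV (\<lambda>_. S \<Otimes>\<^sub>M A))" for \<omega>
  proof -
    have "\<omega> t \<in> states M \<times> actions M" using that by (auto simp: space_PiM space_pair_measure)
    then show ?thesis using b[of "fst (\<omega> t)" "snd (\<omega> t)"] by auto
  qed
  show "integrable law (\<lambda>\<omega>. g (\<omega> t))" "\<bar>LINT \<omega>|law. g (\<omega> t)\<bar> \<le> b"
    by (rule prob_algebra_integral_bound[OF law_prob_algebra m], erule bd)+
qed

text \<open>A step draws the state from \<open>K\<close> and then the action from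
  \<open>\<pi>\<close>, so its expectation is an iterated integral; a change of variables undoes the
  inner push-forward.\<close>

lemma integral_step_kernel:
  fixes g :: "'z \<times> 'a \<Rightarrow> real"
  assumes h: "h \<in> space (\<Pi>\<^sub>M i\<in>{0..<t}. S \<Otimes>\<^sub>M A)"
    and g: "g \<in> borel_measurable (S \<Otimes>\<^sub>M A)"
    and b: "\<And>z a. z \<in> states M \<Longrightarrow> a \<in> actions M \<Longrightarrow> \<bar>g (z, a)\<bar> \<le> b"
  defines "K \<equiv> (case t of 0 \<Rightarrow> return S z\<^sub>0 | Suc s \<Rightarrow> transition M (fst (h s)) (snd (h s)))"
  shows "K \<in> space (prob_algebra S)"
    and "(LINT x|step_kernel M \<pi> z\<^sub>0 t h. g x) = (LINT z|K. LINT a|\<pi> t (h, z). g (z, a))"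
    and "\<And>z. z \<in> states M \<Longrightarrow> \<pi> t (h, z) \<in> space (prob_algebra A)"
proof -
  show K: "K \<in> space (prob_algebra S)"
  proof (cases t)
    case 0
    then show ?thesis using z\<^sub>0 by (simp add: K_def space_prob_algebra prob_space_return)
  next
    case (Suc s)
    then have "h s \<in> space (S \<Otimes>\<^sub>M A)" using h by (auto simp: space_PiM)
    then show ?thesis using Suc
      by (auto simp: K_def space_pair_measure intro!: transition_prob_algebra)
  qed
  have "\<pi> t \<in> (\<Pi>\<^sub>M i\<in>{0..<t}. S \<Otimes>\<^sub>M A) \<Otimes>\<^sub>M S \<rightarrow>\<^sub>M prob_algebra A"
    using pi by (auto simp: policies_def history_space_def)
  then have p: "(\<lambda>z. \<pi> t (h, z)) \<in> S \<rightarrow>\<^sub>M prob_algebra A"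
    by (rule measurable_compose[OF measurable_Pair1'[OF h]])
  then show pA: "\<pi> t (h, z) \<in> space (prob_algebra A)" if "z \<in> states M" for z
    using measurable_space[OF p, of z] that by simp
  have k: "(\<lambda>z. distr (\<pi> t (h, z)) (S \<Otimes>\<^sub>M A) (\<lambda>a. (z, a))) \<in> S \<rightarrow>\<^sub>M prob_algebra (S \<Otimes>\<^sub>M A)"
    by (rule measurable_distr_prob_space2[OF p]) simp
  have "(LINT x|step_kernel M \<pi> z\<^sub>0 t h. g x)
      = (LINT z|K. LINT x|distr (\<pi> t (h, z)) (S \<Otimes>\<^sub>M A) (\<lambda>a. (z, a)). g x)"
    unfolding step_kernel_def K_def[symmetric]
    by (rule integral_bind_prob_algebra[OF K k g, of b]) (auto simp: space_pair_measure b)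
  also have "\<dots> = (LINT z|K. LINT a|\<pi> t (h, z). g (z, a))"
  proof (rule Bochner_Integration.integral_cong[OF refl])
    fix z assume "z \<in> space K"
    moreover have "space K = states M"
      using K by (auto simp: space_prob_algebra dest: sets_eq_imp_space_eq)
    ultimately have z: "z \<in> states M" by simp
    have sets: "sets (\<pi> t (h, z)) = sets A" using pA[OF z] by (simp add: space_prob_algebra)
    have "Pair z \<in> \<pi> t (h, z) \<rightarrow>\<^sub>M S \<Otimes>\<^sub>M A"
      using z by (simp add: measurable_cong_sets[OF sets refl])
    then show "(LINT x|distr (\<pi> t (h, z)) (S \<Otimes>\<^sub>M A) (\<lambda>a. (z, a)). g x) = (LINT a|\<pi> t (h, z). g (z, a))"
      by (rule integral_distr[OF _ g])
  qed
  finally show "(LINT x|step_kernel M \<pi> z\<^sub>0 t h. g x) = (LINT z|K. LINT a|\<pi> t (h, z). g (z, a))" .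
qed

lemma integral_law_step:
  fixes g :: "'z \<times> 'a \<Rightarrow> real"
  assumes g: "g \<in> borel_measurable (S \<Otimes>\<^sub>M A)"
    and b: "\<And>z a. z \<in> states M \<Longrightarrow> a \<in> actions M \<Longrightarrow> \<bar>g (z, a)\<bar> \<le> b"
  shows "(LINT \<omega>|law. g (\<omega> t)) =
    (LINT \<omega>|law. LINT z|(case t of 0 \<Rightarrow> return S z\<^sub>0 | Suc s \<Rightarrow> transition M (fst (\<omega> s)) (snd (\<omega> s))).
       LINT a|\<pi> t (restrict \<omega> {0..<t}, z). g (z, a))"
proof -
  have "(LINT \<omega>|law. g (\<omega> t)) = (LINT \<omega>|law. LINT x|step_kernel M \<pi> z\<^sub>0 t (restrict \<omega> {0..<t}). g x)"
    unfolding trajectory_law_def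
    by (rule IT.integral_lim_component[where g=g and n=t and B=b]) (use g b in \<open>auto simp: space_pair_measure\<close>)
  also have "\<dots> = (LINT \<omega>|law. LINT z|(case t of 0 \<Rightarrow> return S z\<^sub>0 | Suc s \<Rightarrow> transition M (fst (\<omega> s)) (snd (\<omega> s))).
       LINT a|\<pi> t (restrict \<omega> {0..<t}, z). g (z, a))"
  proof (rule Bochner_Integration.integral_cong[OF refl])
    fix \<omega> assume "\<omega> \<in> space law"
    then have "restrict \<omega> {0..<t} \<in> space (\<Pi>\<^sub>M i\<in>{0..<t}. S \<Otimes>\<^sub>M A)"
      by (auto simp: space_law space_PiM space_pair_measure)
    from integral_step_kernel(2)[OF this g b]
    show "(LINT x|step_kernel M \<pi> z\<^sub>0 t (restrict \<omega> {0..<t}). g x) =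
      (LINT z|(case t of 0 \<Rightarrow> return S z\<^sub>0 | Suc s \<Rightarrow> transition M (fst (\<omega> s)) (snd (\<omega> s))).
       LINT a|\<pi> t (restrict \<omega> {0..<t}, z). g (z, a))"
      \<comment> \<open>For \<open>t = Suc s\<close>, the index \<open>s\<close> lies in
        \<open>{0..<t}\<close>, so the restricted history and \<open>\<omega>\<close> agree
        there.\<close>
      by (cases t) simp_all
  qed
  finally show ?thesis .
qed

text \<open>A function of the state is constant in the action and \<open>\<pi>\<close> is a
  probability kernel, so the action integral disappears.\<close>

lemma integral_law_state:
  fixes h :: "'z \<Rightarrow> real"
  assumes h: "h \<in> borel_measurable S"
    and b: "\<And>z. z \<in> states M \<Longrightarrow> \<bar>h z\<bar> \<le> b"
  shows "(LINT \<omega>|law. h (fst (\<omega> t))) =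
    (LINT \<omega>|law. LINT z|(case t of 0 \<Rightarrow> return S z\<^sub>0 | Suc s \<Rightarrow> transition M (fst (\<omega> s)) (snd (\<omega> s))). h z)"
proof -
  have g: "(\<lambda>x. h (fst x)) \<in> borel_measurable (S \<Otimes>\<^sub>M A)" using h by measurable
  have "(LINT \<omega>|law. h (fst (\<omega> t))) =
    (LINT \<omega>|law. LINT z|(case t of 0 \<Rightarrow> return S z\<^sub>0 | Suc s \<Rightarrow> transition M (fst (\<omega> s)) (snd (\<omega> s))).
       LINT a|\<pi> t (restrict \<omega> {0..<t}, z). h (fst (z, a)))"
    by (rule integral_law_step[OF g, of b]) (simp add: b)
  also have "\<dots> = (LINT \<omega>|law. LINT z|(case t of 0 \<Rightarrow> return S z\<^sub>0 | Suc s \<Rightarrow> transition M (fst (\<omega> s)) (snd (\<omega> s))). h z)"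
  proof (intro Bochner_Integration.integral_cong[OF refl])
    fix \<omega> z assume w: "\<omega> \<in> space law"
      and z: "z \<in> space (case t of 0 \<Rightarrow> return S z\<^sub>0 | Suc s \<Rightarrow> transition M (fst (\<omega> s)) (snd (\<omega> s)))"
    from w have r: "restrict \<omega> {0..<t} \<in> space (\<Pi>\<^sub>M i\<in>{0..<t}. S \<Otimes>\<^sub>M A)"
      by (auto simp: space_law space_PiM space_pair_measure)
    note K = integral_step_kernel(1,3)[OF r g, of b]
    have "(case t of 0 \<Rightarrow> return S z\<^sub>0 | Suc s \<Rightarrow> transition M (fst (\<omega> s)) (snd (\<omega> s))) \<in> space (prob_algebra S)"
      using K(1) by (cases t) (simp_all add: b)
    then have "z \<in> states M"
      using z by (auto simp: space_prob_algebra dest: sets_eq_imp_space_eq)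
    then have "prob_space (\<pi> t (restrict \<omega> {0..<t}, z))"
      using K(2)[of z] by (simp add: b space_prob_algebra)
    then show "(LINT a|\<pi> t (restrict \<omega> {0..<t}, z). h (fst (z, a))) = h z"
      by (simp add: prob_space.prob_space)
  qed
  finally show ?thesis .
qed

text \<open>The terms are dominated by \<open>B * \<beta> ^ t\<close> uniformly over paths, which
  permits exchanging the series with the expectation.\<close>

lemma discounted_cost_sums:
  assumes \<beta>: "0 \<le> \<beta>" "\<beta> < 1"
  shows "(\<lambda>t. \<beta> ^ t * (LINT \<omega>|law. cost M (fst (\<omega> t)) (snd (\<omega> t)))) sums discounted_cost M \<beta> \<pi> z\<^sub>0"
proof -
  define f where "f t \<omega> = \<beta> ^ t * cost M (fst (\<omega> t)) (snd (\<omega> t))" for t and \<omega> :: "nat \<Rightarrow> 'z \<times> 'a"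
  have c: "integrable law (\<lambda>\<omega>. cost M (fst (\<omega> t)) (snd (\<omega> t)))" for t
    by (rule integral_law_component(1)[OF cost_measurable, of B]) (simp add: cost_bound)
  have i: "integrable law (f t)" for t unfolding f_def using c by simp
  have bound: "norm (f t \<omega>) \<le> B * \<beta> ^ t" if "\<omega> \<in> space law" for t \<omega>
  proof -
    have "\<omega> t \<in> states M \<times> actions M" using that by (auto simp: space_law)
    then show ?thesis using \<beta> cost_bound[of "fst (\<omega> t)" "snd (\<omega> t)"]
      by (auto simp: f_def abs_mult mult.commute[of B] intro!: mult_left_mono)
  qed
  interpret L: prob_space law using law_prob_algebra by (simp add: space_prob_algebra)
  have geo: "summable (\<lambda>t. B * \<beta> ^ t)" using \<beta> by (intro summable_mult summable_geometric) auto
  have s1: "AE \<omega> in law. summable (\<lambda>t. norm (f t \<omega>))"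
    using bound by (intro AE_I2 summable_comparison_test'[OF geo, where N=0]) auto
  have s2: "summable (\<lambda>t. LINT \<omega>|law. norm (f t \<omega>))"
  proof (rule summable_comparison_test'[OF geo, where N=0])
    fix t
    have "(LINT \<omega>|law. norm (f t \<omega>)) \<le> B * \<beta> ^ t"
      using i bound by (intro L.integral_le_const AE_I2) auto
    then show "norm (LINT \<omega>|law. norm (f t \<omega>)) \<le> B * \<beta> ^ t" by simp
  qed
  have "(\<lambda>t. integral\<^sup>L law (f t)) sums (\<Sum>t. integral\<^sup>L law (f t))"
    by (rule summable_sums[OF summable_integral[OF i s1 s2]])
  also have "(\<Sum>t. integral\<^sup>L law (f t)) = discounted_cost M \<beta> \<pi> z\<^sub>0"
    unfolding discounted_cost_def integral_suminf[OF i s1 s2, symmetric] f_def ..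
  finally show ?thesis by (simp add: f_def)
qed

lemma integral_law_initial:
  fixes h :: "'z \<Rightarrow> real"
  assumes h: "h \<in> borel_measurable S" and b: "\<And>z. z \<in> states M \<Longrightarrow> \<bar>h z\<bar> \<le> b"
  shows "(LINT \<omega>|law. h (fst (\<omega> 0))) = h z\<^sub>0"
proof -
  interpret L: prob_space law using law_prob_algebra by (simp add: space_prob_algebra)
  have "(LINT z|return S z\<^sub>0. h z) = h z\<^sub>0"
    using z\<^sub>0 by (intro integral_return[OF _ h]) simp
  then show ?thesis using integral_law_state[OF assms, of 0] by (simp add: L.prob_space)
qed

text \<open>Both verification inequalities are obtained from the same telescoping sum, with \<open>\<sigma> = 1\<close> for
  upper and \<open>\<sigma> = -1\<close> for lower bounds.\<close>

lemma verification:
  assumes \<beta>: "0 \<le> \<beta>" "\<beta> < 1"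
    and v: "v \<in> borel_measurable S" and b: "\<And>z. z \<in> states M \<Longrightarrow> \<bar>v z\<bar> \<le> b"
    and step: "\<And>t. (LINT \<omega>|law. \<sigma> * (cost M (fst (\<omega> t)) (snd (\<omega> t))
        + \<beta> * (LINT y|transition M (fst (\<omega> t)) (snd (\<omega> t)). v y) - v (fst (\<omega> t)))) \<le> \<delta>"
  shows "\<sigma> * discounted_cost M \<beta> \<pi> z\<^sub>0 \<le> \<sigma> * v z\<^sub>0 + \<delta> / (1 - \<beta>)"
proof -
  let ?c = "\<lambda>t. LINT \<omega>|law. cost M (fst (\<omega> t)) (snd (\<omega> t))"
  let ?e = "\<lambda>t. LINT \<omega>|law. v (fst (\<omega> t))"
  let ?p = "\<lambda>t. LINT \<omega>|law. LINT y|transition M (fst (\<omega> t)) (snd (\<omega> t)). v y"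
  have ic: "integrable law (\<lambda>\<omega>. cost M (fst (\<omega> t)) (snd (\<omega> t)))" for t
    by (rule integral_law_component(1)[OF cost_measurable, of B]) (simp add: cost_bound)
  have mv: "(\<lambda>x. v (fst x)) \<in> borel_measurable (S \<Otimes>\<^sub>M A)" using v by measurable
  note iv = integral_law_component[OF mv, of b, simplified, OF b]
  have mp: "(\<lambda>x. LINT y|transition M (fst x) (snd x). v y) \<in> borel_measurable (S \<Otimes>\<^sub>M A)"
    by (rule kernel_integral_measurable[OF transition_measurable v])
  have bp: "\<bar>LINT y|transition M z a. v y\<bar> \<le> b" if "z \<in> states M" "a \<in> actions M" for z a
    using prob_algebra_integral_bound(2)[OF transition_prob_algebra[OF that] v] b by simp
  note ip = integral_law_component(1)[OF mp, of b, simplified, OF bp]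
  \<comment> \<open>The tower property in the form that makes the sum telescope: looking one step
    ahead at time \<open>t\<close> gives the expectation at time \<open>Suc t\<close>.\<close>
  have p: "?p t = ?e (Suc t)" for t
    using integral_law_state[OF v b, of "Suc t"] by simp
  have "\<sigma> * discounted_cost M \<beta> \<pi> z\<^sub>0 \<le> \<sigma> * ?e 0 + \<delta> / (1 - \<beta>)"
  proof (rule discounted_sum_le[OF \<beta>])
    show "\<bar>\<sigma> * ?e t\<bar> \<le> \<bar>\<sigma>\<bar> * b" for t
      using iv(2)[of t] by (simp add: abs_mult mult_left_mono)
    show "\<sigma> * ?c t + \<beta> * (\<sigma> * ?e (Suc t)) \<le> \<sigma> * ?e t + \<delta>" for t
    proof -
      have "(LINT \<omega>|law. \<sigma> * (cost M (fst (\<omega> t)) (snd (\<omega> t))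
        + \<beta> * (LINT y|transition M (fst (\<omega> t)) (snd (\<omega> t)). v y) - v (fst (\<omega> t))))
         = \<sigma> * (?c t + \<beta> * ?p t - ?e t)"
        using ic[of t] iv(1)[of t] ip[of t] by simp
      with step[of t] show ?thesis by (simp add: p algebra_simps)
    qed
    show "(\<lambda>t. \<beta> ^ t * (\<sigma> * ?c t)) sums (\<sigma> * discounted_cost M \<beta> \<pi> z\<^sub>0)"
      using sums_mult[OF discounted_cost_sums[OF \<beta>], of \<sigma>] by (simp add: algebra_simps)
  qed
  then show ?thesis by (simp add: integral_law_initial[OF v b])
qed

end

text \<open>The inequality is required at every admissible state-action pair, hence holds along
  every path, however the policy uses its history. This is \<open>verification\<close> with sign -1
  and no slack.\<close>

lemma verification_lower:
  assumes pi: "\<pi> \<in> policies M" and z\<^sub>0: "z\<^sub>0 \<in> states M" and \<beta>: "0 \<le> \<beta>" "\<beta> < 1"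
    and v: "v \<in> borel_measurable S" and b: "\<And>z. z \<in> states M \<Longrightarrow> \<bar>v z\<bar> \<le> b"
    and step: "\<And>z a. z \<in> states M \<Longrightarrow> a \<in> actions M \<Longrightarrow>
      v z \<le> cost M z a + \<beta> * (LINT y|transition M z a. v y)"
  shows "v z\<^sub>0 \<le> discounted_cost M \<beta> \<pi> z\<^sub>0"
proof -
  have "(- 1) * discounted_cost M \<beta> \<pi> z\<^sub>0 \<le> (- 1) * v z\<^sub>0 + 0 / (1 - \<beta>)"
  proof (rule verification[OF pi z\<^sub>0 \<beta> v b])
    fix t
    have "0 \<le> (LINT \<omega>|trajectory_law M \<pi> z\<^sub>0. cost M (fst (\<omega> t)) (snd (\<omega> t))
        + \<beta> * (LINT y|transition M (fst (\<omega> t)) (snd (\<omega> t)). v y) - v (fst (\<omega> t)))"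
    proof (rule integral_nonneg_AE[OF AE_I2])
      fix \<omega> assume "\<omega> \<in> space (trajectory_law M \<pi> z\<^sub>0)"
      then have "\<omega> t \<in> states M \<times> actions M" by (auto simp: space_law[OF pi z\<^sub>0])
      then show "0 \<le> cost M (fst (\<omega> t)) (snd (\<omega> t))
        + \<beta> * (LINT y|transition M (fst (\<omega> t)) (snd (\<omega> t)). v y) - v (fst (\<omega> t))"
        using step[of "fst (\<omega> t)" "snd (\<omega> t)"] by auto
    qed
    then show "(LINT \<omega>|trajectory_law M \<pi> z\<^sub>0. - 1 * (cost M (fst (\<omega> t)) (snd (\<omega> t))
        + \<beta> * (LINT y|transition M (fst (\<omega> t)) (snd (\<omega> t)). v y) - v (fst (\<omega> t)))) \<le> 0"
      by (subst integral_mult_right_zero) simp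
  qed auto
  then show ?thesis by simp
qed

lemma stationary_policy_in_policies:
  assumes f: "f \<in> S \<rightarrow>\<^sub>M A"
  shows "stationary_policy M f \<in> policies M"
proof -
  have "(\<lambda>x. return A (f (snd x))) \<in> history_space M t \<rightarrow>\<^sub>M prob_algebra A" for t
    unfolding history_space_def
    by (rule measurable_compose[OF measurable_compose[OF measurable_snd f] measurable_return_prob_space])
  then show ?thesis by (simp add: policies_def stationary_policy_def case_prod_beta)
qed

text \<open>Here the inequality is available only at the actions that \<open>f\<close> selects.
  Integrating over the Dirac measure at \<open>f z\<close> turns \<open>g\<close> into a function
  \<open>h\<close> of the state, so no almost sure statement about the actions is needed.\<close>

lemma verification_stationary:
  assumes f: "f \<in> S \<rightarrow>\<^sub>M A" and z\<^sub>0: "z\<^sub>0 \<in> states M" and \<beta>: "0 \<le> \<beta>" "\<beta> < 1"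
    and v: "v \<in> borel_measurable S" and b: "\<And>z. z \<in> states M \<Longrightarrow> \<bar>v z\<bar> \<le> b"
    and step: "\<And>z. z \<in> states M \<Longrightarrow>
      \<sigma> * (cost M z (f z) + \<beta> * (LINT y|transition M z (f z). v y) - v z) \<le> \<delta>"
  shows "\<sigma> * discounted_cost M \<beta> (stationary_policy M f) z\<^sub>0 \<le> \<sigma> * v z\<^sub>0 + \<delta> / (1 - \<beta>)"
proof (rule verification[OF stationary_policy_in_policies[OF f] z\<^sub>0 \<beta> v b])
  fix t
  let ?\<pi> = "stationary_policy M f"
  let ?L = "trajectory_law M ?\<pi> z\<^sub>0"
  note pi = stationary_policy_in_policies[OF f]
  define g where "g x = \<sigma> * (cost M (fst x) (snd x) + \<beta> * (LINT y|transition M (fst x) (snd x). v y) - v (fst x))"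
    for x :: "'z \<times> 'a"
  define h where "h z = g (z, f z)" for z
  have bp: "\<bar>LINT y|transition M z a. v y\<bar> \<le> b" if "z \<in> states M" "a \<in> actions M" for z a
    using prob_algebra_integral_bound(2)[OF transition_prob_algebra[OF that] v] b by simp
  have mp: "(\<lambda>x. LINT y|transition M (fst x) (snd x). v y) \<in> borel_measurable (S \<Otimes>\<^sub>M A)"
    by (rule kernel_integral_measurable[OF transition_measurable v])
  have g: "g \<in> borel_measurable (S \<Otimes>\<^sub>M A)"
    unfolding g_def using cost_measurable mp v by measurable
  have gb: "\<bar>g (z, a)\<bar> \<le> \<bar>\<sigma>\<bar> * (B + \<beta> * b + b)" if za: "z \<in> states M" "a \<in> actions M" for z a
  proof -
    have "\<bar>\<beta> * (LINT y|transition M z a. v y)\<bar> \<le> \<beta> * b"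
      using bp[OF za] \<beta> by (simp add: abs_mult mult_left_mono)
    then have "\<bar>cost M z a + \<beta> * (LINT y|transition M z a. v y) - v z\<bar> \<le> B + \<beta> * b + b"
      using cost_bound[OF za] b[OF za(1)] by linarith
    then show ?thesis by (simp add: g_def abs_mult mult_left_mono)
  qed
  have fA: "f z \<in> actions M" if "z \<in> states M" for z
    using measurable_space[OF f, of z] that by simp
  have h: "h \<in> borel_measurable S" unfolding h_def using g f by measurable
  have hb: "\<bar>h z\<bar> \<le> \<bar>\<sigma>\<bar> * (B + \<beta> * b + b)" if "z \<in> states M" for z
    unfolding h_def using gb fA that by simp
  interpret L: prob_space ?L
    using law_prob_algebra[OF pi z\<^sub>0] by (simp add: space_prob_algebra)
  let ?K = "\<lambda>\<omega>. case t of 0 \<Rightarrow> return S z\<^sub>0 | Suc s \<Rightarrow> transition M (fst (\<omega> s)) (snd (\<omega> s))"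
  have "(LINT \<omega>|?L. g (\<omega> t)) = (LINT \<omega>|?L. LINT z|?K \<omega>. LINT a|?\<pi> t (restrict \<omega> {0..<t}, z). g (z, a))"
    by (rule integral_law_step[OF pi z\<^sub>0 g gb])
  also have "\<dots> = (LINT \<omega>|?L. LINT z|?K \<omega>. h z)"
  proof (intro Bochner_Integration.integral_cong[OF refl])
    fix \<omega> z assume w: "\<omega> \<in> space ?L" and z: "z \<in> space (?K \<omega>)"
    from w have r: "restrict \<omega> {0..<t} \<in> space (\<Pi>\<^sub>M i\<in>{0..<t}. S \<Otimes>\<^sub>M A)"
      by (auto simp: space_law[OF pi z\<^sub>0] space_PiM space_pair_measure)
    have "?K \<omega> \<in> space (prob_algebra S)"
      using integral_step_kernel(1)[OF pi z\<^sub>0 r g gb] by (cases t) simp_all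
    then have z': "z \<in> states M"
      using z by (auto simp: space_prob_algebra dest: sets_eq_imp_space_eq)
    have "(\<lambda>a. g (z, a)) \<in> borel_measurable A"
      using z' by (intro measurable_compose[OF measurable_Pair1' g]) simp
    then show "(LINT a|?\<pi> t (restrict \<omega> {0..<t}, z). g (z, a)) = h z"
      using fA[OF z'] by (simp add: stationary_policy_def h_def integral_return)
  qed
  also have "\<dots> = (LINT \<omega>|?L. h (fst (\<omega> t)))"
    by (rule integral_law_state[OF pi z\<^sub>0 h hb, symmetric])
  also have "\<dots> \<le> \<delta>"
  proof (rule L.integral_le_const[OF _ AE_I2])
    show "integrable ?L (\<lambda>\<omega>. h (fst (\<omega> t)))"
      using integral_law_component(1)[OF pi z\<^sub>0, of "\<lambda>x. h (fst x)" _ t] h hb by auto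
    fix \<omega> assume "\<omega> \<in> space ?L"
    then have "fst (\<omega> t) \<in> states M" by (auto simp: space_law[OF pi z\<^sub>0] PiE_iff mem_Times_iff)
    then show "h (fst (\<omega> t)) \<le> \<delta>" using step by (simp add: h_def g_def)
  qed
  finally show "(LINT \<omega>|?L. \<sigma> * (cost M (fst (\<omega> t)) (snd (\<omega> t))
        + \<beta> * (LINT y|transition M (fst (\<omega> t)) (snd (\<omega> t)). v y) - v (fst (\<omega> t)))) \<le> \<delta>"
    by (simp add: g_def)
qed auto

end

section \<open>Contractions and policy evaluation\<close>

text \<open>Banach iteration without a normed space: arbitrary bounds \<open>s\<close> on
  \<open>Z\<close> replace the distance, and closure of \<open>C\<close> under pointwise limits
  replaces completeness. \<open>C\<close> will be bounded measurable functions for policy evaluation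
  and Lipschitz functions for the Bellman operator.\<close>

lemma contraction_fixed_point:
  fixes F :: "('z \<Rightarrow> real) \<Rightarrow> 'z \<Rightarrow> real"
  assumes \<beta>: "0 \<le> \<beta>" "\<beta> < 1"
    and F: "\<And>g. g \<in> C \<Longrightarrow> F g \<in> C"
    and contr: "\<And>g h s z. g \<in> C \<Longrightarrow> h \<in> C \<Longrightarrow> (\<And>y. y \<in> Z \<Longrightarrow> \<bar>g y - h y\<bar> \<le> s) \<Longrightarrow> z \<in> Z \<Longrightarrow>
      \<bar>F g z - F h z\<bar> \<le> \<beta> * s"
    and closed: "\<And>w g. (\<And>k. w k \<in> C) \<Longrightarrow> (\<And>z. z \<in> Z \<Longrightarrow> (\<lambda>k. w k z) \<longlonglongrightarrow> g z) \<Longrightarrow> g \<in> C"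
    and g\<^sub>0: "g\<^sub>0 \<in> C" "\<And>z. z \<in> Z \<Longrightarrow> \<bar>F g\<^sub>0 z - g\<^sub>0 z\<bar> \<le> b"
  shows "\<exists>g\<in>C. \<forall>z\<in>Z. F g z = g z"
proof -
  define w where "w k = (F ^^ k) g\<^sub>0" for k
  \<comment> \<open>The geometric sum of all increments, which bounds the distance of every iterate
    from \<open>g\<^sub>0\<close>.\<close>
  define D where "D = b / (1 - \<beta>)"
  have D: "b + \<beta> * D = D" using \<beta> by (simp add: D_def field_simps)
  have wC: "w k \<in> C" for k by (induction k) (simp_all add: w_def g\<^sub>0 F)
  have w0: "\<bar>w k z - g\<^sub>0 z\<bar> \<le> D" if "z \<in> Z" for k z
    using that
  proof (induction k arbitrary: z)
    case 0
    then have "0 \<le> b" using g\<^sub>0(2)[of z] by linarith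
    then show ?case using \<beta> by (simp add: w_def D_def)
  next
    case (Suc k)
    have "\<bar>F (w k) z - F g\<^sub>0 z\<bar> \<le> \<beta> * D"
      by (rule contr[OF wC g\<^sub>0(1) Suc.IH Suc.prems])
    then show ?case using g\<^sub>0(2)[OF Suc.prems] D by (simp add: w_def)
  qed
  \<comment> \<open>The bound on \<open>w k - g\<^sub>0\<close> contracted \<open>n\<close> times.
    Uniformity in \<open>k\<close> gives the Cauchy property, uniformity in \<open>z\<close> is
    needed for the limit.\<close>
  have wn: "\<bar>w (n + k) z - w n z\<bar> \<le> \<beta> ^ n * D" if "z \<in> Z" for n k z
    using that
  proof (induction n arbitrary: z)
    case 0
    then show ?case using w0 by (simp add: w_def)
  next
    case (Suc n)
    have "\<bar>F (w (n + k)) z - F (w n) z\<bar> \<le> \<beta> * (\<beta> ^ n * D)"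
      by (rule contr[OF wC wC Suc.IH Suc.prems])
    then show ?case by (simp add: w_def mult.assoc)
  qed
  have D0: "(\<lambda>n. \<beta> ^ n * D) \<longlonglongrightarrow> 0"
    using \<beta> by (intro tendsto_mult_left_zero LIMSEQ_realpow_zero)
  have "convergent (\<lambda>k. w k z)" if z: "z \<in> Z" for z
  proof (rule Cauchy_convergent, rule CauchyI')
    fix e :: real assume "0 < e"
    from order_tendstoD(2)[OF D0 this] obtain n\<^sub>0 where n\<^sub>0: "\<beta> ^ n * D < e" if "n \<ge> n\<^sub>0" for n
      by (auto simp: eventually_sequentially)
    show "\<exists>M. \<forall>m\<ge>M. \<forall>n>m. dist (w m z) (w n z) < e"
    proof (intro exI allI impI)
      fix m n assume "n\<^sub>0 \<le> m" "m < n"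
      then show "dist (w m z) (w n z) < e"
        using wn[OF z, of m "n - m"] n\<^sub>0[of m] by (simp add: dist_real_def abs_minus_commute)
    qed
  qed
  then have lim: "(\<lambda>k. w k z) \<longlonglongrightarrow> lim (\<lambda>k. w k z)" if "z \<in> Z" for z
    using that by (simp add: convergent_LIMSEQ_iff)
  define g where "g z = lim (\<lambda>k. w k z)" for z
  have g: "(\<lambda>k. w k z) \<longlonglongrightarrow> g z" if "z \<in> Z" for z using lim[OF that] by (simp add: g_def)
  have gC: "g \<in> C" by (rule closed[OF wC g])
  \<comment> \<open>Pointwise convergence does not pass through \<open>F\<close>;
    \<open>contr\<close> needs a bound on all of \<open>Z\<close>.\<close>
  have gw: "\<bar>g z - w n z\<bar> \<le> \<beta> ^ n * D" if "z \<in> Z" for n z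
  proof (rule LIMSEQ_le_const2)
    show "(\<lambda>k. \<bar>w (k + n) z - w n z\<bar>) \<longlonglongrightarrow> \<bar>g z - w n z\<bar>"
      by (intro tendsto_intros LIMSEQ_ignore_initial_segment g that)
    show "\<exists>N. \<forall>k\<ge>N. \<bar>w (k + n) z - w n z\<bar> \<le> \<beta> ^ n * D"
      using wn[OF that, of n] by (simp add: add.commute)
  qed
  have "F g z = g z" if z: "z \<in> Z" for z
  proof (rule LIMSEQ_unique)
    show "(\<lambda>k. w (Suc k) z) \<longlonglongrightarrow> g z" by (rule LIMSEQ_Suc[OF g[OF z]])
    have "(\<lambda>k. w (Suc k) z - F g z) \<longlonglongrightarrow> 0"
    proof (rule Lim_null_comparison)
      show "(\<lambda>k. \<beta> * (\<beta> ^ k * D)) \<longlonglongrightarrow> 0" by (intro tendsto_mult_right_zero D0)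
      have "\<bar>F g z - F (w k) z\<bar> \<le> \<beta> * (\<beta> ^ k * D)" for k
        by (rule contr[OF gC wC gw z])
      then show "\<forall>\<^sub>F k in sequentially. norm (w (Suc k) z - F g z) \<le> \<beta> * (\<beta> ^ k * D)"
        by (simp add: w_def abs_minus_commute)
    qed
    then show "(\<lambda>k. w (Suc k) z) \<longlonglongrightarrow> F g z" by (simp add: LIM_zero_iff)
  qed
  then show ?thesis using gC by blast
qed

text \<open>The supremum of \<open>h\<close> is itself an admissible \<open>s\<close>, so
  \<open>sup \<le> C + \<beta> * sup\<close>. The a priori bound \<open>b\<close> makes it finite,
  so that the inequality can be solved.\<close>

lemma contraction_upper_bound:
  fixes h :: "'z \<Rightarrow> real"
  assumes \<beta>: "0 \<le> \<beta>" "\<beta> < 1" and b: "\<And>z. z \<in> Z \<Longrightarrow> h z \<le> b"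
    and step: "\<And>s z. (\<And>y. y \<in> Z \<Longrightarrow> h y \<le> s) \<Longrightarrow> z \<in> Z \<Longrightarrow> h z \<le> C + \<beta> * s"
    and z: "z \<in> Z"
  shows "h z \<le> C / (1 - \<beta>)"
proof -
  have le: "h y \<le> (SUP y\<in>Z. h y)" if "y \<in> Z" for y
    by (rule cSUP_upper[OF that bdd_aboveI2]) (rule b)
  have "(SUP y\<in>Z. h y) \<le> C + \<beta> * (SUP y\<in>Z. h y)"
    by (rule cSUP_least) (use z step[OF le] in auto)
  then have "(SUP y\<in>Z. h y) \<le> C / (1 - \<beta>)" using \<beta> by (simp add: field_simps)
  with le[OF z] show ?thesis by simp
qed

text \<open>Dividing by \<open>L\<close> gives a test function of constant 1. For
  \<open>L = 0\<close> this is impossible, but then \<open>g\<close> is constant and both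
  probability measures integrate it to the same value.\<close>

lemma wasserstein1_lipschitz_integral:
  fixes g :: "'z::metric_space \<Rightarrow> real"
  assumes g: "L-lipschitz_on Z g" and W: "wasserstein1 Z \<mu> \<xi> \<le> ereal r"
    and \<mu>: "\<mu> \<in> space (prob_algebra (restrict_space borel Z))"
    and \<xi>: "\<xi> \<in> space (prob_algebra (restrict_space borel Z))"
  shows "\<bar>(LINT z|\<mu>. g z) - (LINT z|\<xi>. g z)\<bar> \<le> L * r"
proof (cases "L = 0")
  case True
  have sp: "space \<mu> = Z" "space \<xi> = Z"
    using \<mu> \<xi> by (auto simp: space_prob_algebra space_restrict_space dest!: sets_eq_imp_space_eq)
  interpret m: prob_space \<mu> using \<mu> by (simp add: space_prob_algebra)
  interpret x: prob_space \<xi> using \<xi> by (simp add: space_prob_algebra)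
  obtain z where z: "z \<in> Z" using m.not_empty sp by auto
  have c: "g y = g z" if "y \<in> Z" for y
    using lipschitz_onD[OF g that z] True by simp
  have "(LINT y|\<mu>. g y) = (LINT y|\<mu>. g z)" "(LINT y|\<xi>. g y) = (LINT y|\<xi>. g z)"
    by (rule Bochner_Integration.integral_cong[OF refl], simp add: sp c)+
  then show ?thesis using True by (simp add: m.prob_space x.prob_space)
next
  case False
  then have L: "0 < L" using lipschitz_on_nonneg[OF g] by simp
  have "(inverse L * L)-lipschitz_on Z (\<lambda>z. inverse L *\<^sub>R g z)"
    using lipschitz_on_cmult_nonneg[OF g, of "inverse L"] L by simp
  then have "1-lipschitz_on Z (\<lambda>z. inverse L * g z)" using L by simp
  then have "ereal \<bar>(LINT z|\<mu>. inverse L * g z) - (LINT z|\<xi>. inverse L * g z)\<bar> \<le> wasserstein1 Z \<mu> \<xi>"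
    unfolding wasserstein1_def by (intro SUP_upper) simp
  with W have "\<bar>(LINT z|\<mu>. inverse L * g z) - (LINT z|\<xi>. inverse L * g z)\<bar> \<le> r"
    using order_trans by fastforce
  then have "inverse L * \<bar>(LINT z|\<mu>. g z) - (LINT z|\<xi>. g z)\<bar> \<le> r"
    using L by (simp add: right_diff_distrib[symmetric] abs_mult)
  then show ?thesis using L by (simp add: field_simps)
qed

lemma cINF_diff_le:
  fixes f g :: "'a \<Rightarrow> real"
  assumes "X \<noteq> {}" "bdd_below (f ` X)" "bdd_below (g ` X)"
    and "\<And>x. x \<in> X \<Longrightarrow> \<bar>f x - g x\<bar> \<le> s"
  shows "\<bar>(INF x\<in>X. f x) - (INF x\<in>X. g x)\<bar> \<le> s"
proof -
  have "(INF x\<in>X. f x) - s \<le> (INF x\<in>X. g x)"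
    by (rule cINF_greatest[OF assms(1)])
       (smt (verit) assms(2,4) cINF_lower)
  moreover have "(INF x\<in>X. g x) - s \<le> (INF x\<in>X. f x)"
    by (rule cINF_greatest[OF assms(1)])
       (smt (verit) assms(3,4) cINF_lower)
  ultimately show ?thesis by linarith
qed

section \<open>The discounted cost of a stationary policy as a fixed point\<close>

context bounded_mdp
begin

text \<open>The fixed point of the one-step operator is constructed first, with measurability and
  bound built in. Verification with both signs and slack 0 then identifies it with the discounted
  cost, so shifted trajectories are never considered.\<close>

lemma policy_evaluation:
  assumes f: "f \<in> S \<rightarrow>\<^sub>M A" and \<beta>: "0 \<le> \<beta>" "\<beta> < 1"
  obtains u where "u \<in> borel_measurable S" "\<And>z. z \<in> states M \<Longrightarrow> \<bar>u z\<bar> \<le> B / (1 - \<beta>)"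
    "\<And>z. z \<in> states M \<Longrightarrow> u z = cost M z (f z) + \<beta> * (LINT y|transition M z (f z). u y)"
    "\<And>z. z \<in> states M \<Longrightarrow> discounted_cost M \<beta> (stationary_policy M f) z = u z"
proof -
  have fA: "f z \<in> actions M" if "z \<in> states M" for z
    using measurable_space[OF f, of z] that by simp
  define D where "D = B / (1 - \<beta>)"
  have D: "B + \<beta> * D = D" using \<beta> by (simp add: D_def field_simps)
  define C where "C = {g \<in> borel_measurable S. \<forall>z\<in>states M. \<bar>g z\<bar> \<le> D}"
  define F where "F g z = cost M z (f z) + \<beta> * (LINT y|transition M z (f z). g y)" for g z
  have graph: "(\<lambda>z. (z, f z)) \<in> S \<rightarrow>\<^sub>M S \<Otimes>\<^sub>M A" using f by simp
  have k: "(\<lambda>z. transition M z (f z)) \<in> S \<rightarrow>\<^sub>M prob_algebra S"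
    using measurable_compose[OF graph transition_measurable] by simp
  have c: "(\<lambda>z. cost M z (f z)) \<in> borel_measurable S"
    using measurable_compose[OF graph cost_measurable] by simp
  have bd: "\<bar>LINT y|transition M z (f z). g y\<bar> \<le> s" "integrable (transition M z (f z)) g"
    if "z \<in> states M" "g \<in> borel_measurable S" "\<And>y. y \<in> states M \<Longrightarrow> \<bar>g y\<bar> \<le> s"
    for z s and g :: "'z \<Rightarrow> real"
    using prob_algebra_integral_bound[OF transition_prob_algebra[OF that(1) fA[OF that(1)]] that(2)] that(3)
    by auto
  have "\<exists>g\<in>C. \<forall>z\<in>states M. F g z = g z"
  proof (rule contraction_fixed_point[OF \<beta>])
    fix g assume g: "g \<in> C"
    have "\<bar>F g z\<bar> \<le> D" if z: "z \<in> states M" for z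
    proof -
      have "\<bar>\<beta> * (LINT y|transition M z (f z). g y)\<bar> \<le> \<beta> * D"
        using bd(1)[OF z, of g D] g \<beta> by (simp add: abs_mult mult_left_mono C_def)
      then show ?thesis using cost_bound[OF z fA[OF z]] D by (simp add: F_def)
    qed
    moreover have "F g \<in> borel_measurable S"
      unfolding F_def using g
      by (intro borel_measurable_add borel_measurable_times borel_measurable_const c kernel_integral_measurable[OF k])
         (simp add: C_def)
    ultimately show "F g \<in> C" by (simp add: C_def)
  next
    fix g h s z assume g: "g \<in> C" and h: "h \<in> C" and s: "\<And>y. y \<in> states M \<Longrightarrow> \<bar>g y - h y\<bar> \<le> s"
      and z: "z \<in> states M"
    have "\<bar>LINT y|transition M z (f z). g y - h y\<bar> \<le> s"
      using g h s by (intro bd(1)[OF z]) (auto simp: C_def)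
    moreover have "(LINT y|transition M z (f z). g y - h y)
        = (LINT y|transition M z (f z). g y) - (LINT y|transition M z (f z). h y)"
      using g h by (intro Bochner_Integration.integral_diff bd(2)[OF z]) (auto simp: C_def)
    ultimately show "\<bar>F g z - F h z\<bar> \<le> \<beta> * s"
      using \<beta> by (simp add: F_def right_diff_distrib[symmetric] abs_mult mult_left_mono)
  next
    fix w g assume w: "\<And>k. w k \<in> C" and lim: "\<And>z. z \<in> states M \<Longrightarrow> (\<lambda>k. w k z) \<longlonglongrightarrow> g z"
    have "g \<in> borel_measurable S"
      by (rule borel_measurable_LIMSEQ_real[of _ w]) (use w lim in \<open>auto simp: C_def\<close>)
    moreover have "\<bar>g z\<bar> \<le> D" if "z \<in> states M" for z
      by (rule LIMSEQ_le_const2[OF tendsto_rabs[OF lim[OF that]]]) (use w that in \<open>auto simp: C_def\<close>)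
    ultimately show "g \<in> C" by (simp add: C_def)
  next
    \<comment> \<open>\<open>B\<close> is known to be nonnegative only once a state exists, and
      membership in \<open>C\<close> asks for \<open>0 \<le> D\<close> only at states.\<close>
    have *: "0 \<le> D" if "z \<in> states M" for z
      using cost_bound[OF that fA[OF that]] \<beta> by (auto simp: D_def)
    then show "(\<lambda>_. 0) \<in> C" by (simp add: C_def)
    show "\<bar>F (\<lambda>_. 0) z - 0\<bar> \<le> B" if "z \<in> states M" for z
      using cost_bound[OF that fA[OF that]] by (simp add: F_def)
  qed
  then obtain u where u: "u \<in> C" "\<And>z. z \<in> states M \<Longrightarrow> F u z = u z" by blast
  have um: "u \<in> borel_measurable S" and ub: "\<And>z. z \<in> states M \<Longrightarrow> \<bar>u z\<bar> \<le> D"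
    using u by (auto simp: C_def)
  show ?thesis
  proof (rule that[OF um ub[unfolded D_def]])
    show eq: "u z = cost M z (f z) + \<beta> * (LINT y|transition M z (f z). u y)" if "z \<in> states M" for z
      using u(2)[OF that] by (simp add: F_def)
    show "discounted_cost M \<beta> (stationary_policy M f) z = u z" if z: "z \<in> states M" for z
    proof -
      have "\<sigma> * discounted_cost M \<beta> (stationary_policy M f) z \<le> \<sigma> * u z + 0 / (1 - \<beta>)" for \<sigma> :: real
        by (rule verification_stationary[OF f z \<beta> um ub]) (simp_all add: eq[symmetric])
      from this[of 1] this[of "-1"] show ?thesis by simp
    qed
  qed
qed

text \<open>The infimum is real, so boundedness below comes first: the constant
  \<open>- (B / (1 - \<beta>))\<close> meets the condition of
  \<open>verification_lower\<close>.\<close>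

lemma value_function_le:
  assumes pi: "\<pi> \<in> policies M" and z: "z \<in> states M" and \<beta>: "0 \<le> \<beta>" "\<beta> < 1"
  shows "value_function M \<beta> z \<le> discounted_cost M \<beta> \<pi> z"
  unfolding value_function_def
proof (rule cINF_lower[OF _ pi], rule bdd_belowI2)
  fix \<rho> assume "\<rho> \<in> policies M"
  then show "- (B / (1 - \<beta>)) \<le> discounted_cost M \<beta> \<rho> z"
  proof (rule verification_lower[OF _ z \<beta>])
    fix x a assume xa: "x \<in> states M" "a \<in> actions M"
    interpret prob_space "transition M x a"
      using transition_prob_algebra[OF xa] by (simp add: space_prob_algebra)
    have "\<beta> * (B / (1 - \<beta>)) = B / (1 - \<beta>) - B" using \<beta> by (simp add: field_simps)
    then show "- (B / (1 - \<beta>)) \<le> cost M x a + \<beta> * (LINT y|transition M x a. - (B / (1 - \<beta>)))"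
      using cost_bound[OF xa] by (simp add: prob_space)
  qed auto
qed

end

section \<open>The finite-state model\<close>

context bounded_mdp
begin

lemma transition_slice: "a \<in> actions M \<Longrightarrow> (\<lambda>z. transition M z a) \<in> S \<rightarrow>\<^sub>M prob_algebra S"
  using measurable_compose[OF measurable_Pair2'[of a A S] transition_measurable] by simp

lemma cost_slice: "a \<in> actions M \<Longrightarrow> (\<lambda>z. cost M z a) \<in> borel_measurable S"
  using measurable_compose[OF measurable_Pair2'[of a A S] cost_measurable] by simp

text \<open>The state-action value function, unrelated to the quantizer \<open>Q\<close>. The action
  stays a parameter because the finite model averages over a cell with the action held
  fixed.\<close>

definition q_value :: "real \<Rightarrow> ('z \<Rightarrow> real) \<Rightarrow> 'z \<Rightarrow> 'a \<Rightarrow> real" where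
  "q_value \<beta> v z a = cost M z a + \<beta> * (LINT y|transition M z a. v y)"

lemma q_value_bounded:
  assumes "a \<in> actions M" "v \<in> borel_measurable S" "\<And>y. y \<in> states M \<Longrightarrow> \<bar>v y\<bar> \<le> b" "0 \<le> \<beta>" "z \<in> states M"
  shows "\<bar>q_value \<beta> v z a\<bar> \<le> B + \<beta> * b"
proof -
  have "\<bar>LINT y|transition M z a. v y\<bar> \<le> b"
    using prob_algebra_integral_bound(2)[OF transition_prob_algebra[OF assms(5,1)] assms(2)] assms(3) by simp
  then have "\<bar>\<beta> * (LINT y|transition M z a. v y)\<bar> \<le> \<beta> * b"
    using assms(4) by (simp add: abs_mult mult_left_mono)
  then show ?thesis using cost_bound[OF assms(5,1)] by (simp add: q_value_def)
qed

lemma q_value_measurable: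
  assumes "a \<in> actions M" "v \<in> borel_measurable S"
  shows "(\<lambda>z. q_value \<beta> v z a) \<in> borel_measurable S"
  unfolding q_value_def
  by (intro borel_measurable_add borel_measurable_times borel_measurable_const cost_slice[OF assms(1)]
      kernel_integral_measurable[OF transition_slice[OF assms(1)] assms(2)])

end

text \<open>The measure-theoretic side of the finite model. How far \<open>Q\<close> moves a state
  enters with \<open>lipschitz_approximation\<close>.\<close>

locale finite_approximation = bounded_mdp M B
  for M :: "('z::polish_space, 'a::polish_space) mdp" and B +
  fixes Y :: "'z set" and Q :: "'z \<Rightarrow> 'z" and \<nu> :: "'z measure"
  assumes Y: "Y \<subseteq> states M" "finite Y"
    and Q_measurable: "Q \<in> restrict_space borel (states M) \<rightarrow>\<^sub>M restrict_space borel Y"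
    and \<nu>: "\<nu> \<in> space (prob_algebra (state_space M))"
    and cell_pos: "\<And>x. x \<in> Y \<Longrightarrow> measure \<nu> (cell (states M) Q x) > 0"
begin

abbreviation "N \<equiv> finite_model M Y Q \<nu>"
abbreviation "cond x \<equiv> uniform_measure \<nu> (cell (states M) Q x)"

lemma N_simps [simp]: "states N = Y" "actions N = actions M" "action_space N = A"
  by (simp_all add: finite_model_def action_space_def)

lemma Q_measurable' [measurable]: "Q \<in> S \<rightarrow>\<^sub>M state_space N"
  using Q_measurable by (simp add: state_space_def)

lemma space_N [simp]: "space (state_space N) = Y"
  by (simp add: state_space_def space_restrict_space)

lemma Q_in: "z \<in> states M \<Longrightarrow> Q z \<in> Y"
  using measurable_space[OF Q_measurable', of z] by simp

lemma sets_N: "sets (state_space N) = Pow Y"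
proof
  show "sets (state_space N) \<subseteq> Pow Y" using sets.space_closed[of "state_space N"] by simp
  show "Pow Y \<subseteq> sets (state_space N)"
  proof
    fix X assume "X \<in> Pow Y"
    then have X: "X \<subseteq> Y" by simp
    then have "X \<in> sets borel" using Y(2) by (intro borel_closed finite_imp_closed finite_subset[OF X])
    moreover have "X = Y \<inter> X" using X by auto
    ultimately show "X \<in> sets (state_space N)" by (auto simp: state_space_def sets_restrict_space)
  qed
qed

text \<open>The finite state space is discrete, so any choice of actions at its points is a
  measurable policy.\<close>

lemma measurable_N: "(g \<in> state_space N \<rightarrow>\<^sub>M R) \<longleftrightarrow> (\<forall>x\<in>Y. g x \<in> space R)"
  by (subst measurable_cong_sets[of _ "count_space Y" _ R]) (auto simp: sets_N)

lemma space_\<nu>: "space \<nu> = states M" and sets_\<nu>: "sets \<nu> = sets S"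
  using \<nu> by (auto simp: space_prob_algebra dest: sets_eq_imp_space_eq)

lemma sets_cond: "sets (cond x) = sets S"
  by (simp add: sets_\<nu>)

lemma cell_measurable: "cell (states M) Q x \<in> sets S" if "x \<in> Y"
proof -
  have "Q -` {x} \<inter> space S \<in> sets S"
    by (rule measurable_sets[OF Q_measurable']) (use that in \<open>simp add: sets_N\<close>)
  moreover have "Q -` {x} \<inter> space S = cell (states M) Q x" by (auto simp: cell_def)
  ultimately show ?thesis by simp
qed

lemma cond_prob_algebra: "cond x \<in> space (prob_algebra S)" and AE_cond: "AE z in cond x. z \<in> cell (states M) Q x"
  if x: "x \<in> Y"
proof -
  interpret prob_space \<nu> using \<nu> by (simp add: space_prob_algebra)
  have pos: "emeasure \<nu> (cell (states M) Q x) \<noteq> 0" using cell_pos[OF x] by (simp add: emeasure_eq_measure)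
  have "prob_space (cond x)" by (rule prob_space_uniform_measure[OF pos]) simp
  then show "cond x \<in> space (prob_algebra S)" by (simp add: space_prob_algebra sets_\<nu>)
  show "AE z in cond x. z \<in> cell (states M) Q x"
    by (rule AE_uniform_measureI) (use cell_measurable[OF x] in \<open>auto simp: sets_\<nu>\<close>)
qed

lemma cond_kernel: "cond \<in> state_space N \<rightarrow>\<^sub>M prob_algebra S"
  by (simp add: measurable_N cond_prob_algebra)

text \<open>The point masses describe a three-stage experiment: draw a state from the cell, move it
  by the original kernel, round with \<open>Q\<close>. In this form the calculus of
  \<open>bind\<close> and \<open>distr\<close> applies.\<close>

lemma transition_N:
  assumes x: "x \<in> Y" and a: "a \<in> actions M"
  shows "transition N x a = distr (cond x \<bind> (\<lambda>z. transition M z a)) (state_space N) Q"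
proof (rule measure_eqI_finite[OF _ _ Y(2)])
  show "sets (transition N x a) = Pow Y" by (simp add: finite_model_def sets_point_measure)
  show "sets (distr (cond x \<bind> (\<lambda>z. transition M z a)) (state_space N) Q) = Pow Y" by (simp add: sets_N)
  fix y assume y: "y \<in> Y"
  let ?E = "\<lambda>z. emeasure (transition M z a) (cell (states M) Q y)"
  have sb: "sets (cond x \<bind> (\<lambda>z. transition M z a)) = sets S"
    by (rule sets_bind'[OF cond_prob_algebra[OF x] transition_slice[OF a]])
  have "emeasure (transition N x a) {y} = (\<integral>\<^sup>+z\<in>cell (states M) Q x. ?E z \<partial>cond x)"
    using y Y(2) by (simp add: finite_model_def emeasure_point_measure_finite)
  also have "\<dots> = (\<integral>\<^sup>+z. ?E z \<partial>cond x)"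
    by (rule nn_integral_cong_AE) (use AE_cond[OF x] in eventually_elim, simp)
  also have "\<dots> = emeasure (cond x \<bind> (\<lambda>z. transition M z a)) (cell (states M) Q y)"
    by (rule emeasure_bind_prob_algebra[OF cond_prob_algebra[OF x] transition_slice[OF a] cell_measurable[OF y], symmetric])
  also have "cell (states M) Q y = Q -` {y} \<inter> space (cond x \<bind> (\<lambda>z. transition M z a))"
    using sets_eq_imp_space_eq[OF sb] by (auto simp: cell_def)
  also have "emeasure (cond x \<bind> (\<lambda>z. transition M z a)) \<dots>
      = emeasure (distr (cond x \<bind> (\<lambda>z. transition M z a)) (state_space N) Q) {y}"
    by (rule emeasure_distr[symmetric]) (use y in \<open>simp_all add: measurable_cong_sets[OF sb refl] sets_N\<close>)
  finally show "emeasure (transition N x a) {y}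
      = emeasure (distr (cond x \<bind> (\<lambda>z. transition M z a)) (state_space N) Q) {y}" .
qed

lemma cost_N:
  assumes x: "x \<in> Y" and a: "a \<in> actions M"
  shows "cost N x a = (LINT z|cond x. cost M z a)"
proof -
  have c: "(\<lambda>z. cost M z a) \<in> borel_measurable (cond x)"
    using cost_slice[OF a] by (simp only: measurable_cong_sets[OF sets_cond refl])
  have "cost N x a = (LINT z|cond x. indicator (cell (states M) Q x) z *\<^sub>R cost M z a)"
    by (simp add: finite_model_def set_lebesgue_integral_def)
  also have "\<dots> = (LINT z|cond x. cost M z a)"
  proof (rule integral_cong_AE)
    show "(\<lambda>z. indicator (cell (states M) Q x) z *\<^sub>R cost M z a) \<in> borel_measurable (cond x)"
      using cell_measurable[OF x] by (intro borel_measurable_scaleR borel_measurable_indicator c) (simp add: sets_\<nu>)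
    show "AE z in cond x. indicator (cell (states M) Q x) z *\<^sub>R cost M z a = cost M z a"
      using AE_cond[OF x] by eventually_elim simp
  qed (rule c)
  finally show ?thesis .
qed

text \<open>Joint measurability in state and action is read off the factored transition. In the
  cost, the integrand itself depends on the action, hence
  \<open>kernel_integral_measurable2\<close>.\<close>

lemma is_mdp_N: "is_mdp N"
  unfolding is_mdp_def
proof (intro conjI)
  show "states N \<in> sets borel" using Y(2) by (simp add: finite_imp_closed)
  show "actions N \<in> sets borel" using mdp by (simp add: is_mdp_def)
  have swap: "(\<lambda>(x, z). (z, snd x)) \<in> (state_space N \<Otimes>\<^sub>M A) \<Otimes>\<^sub>M S \<rightarrow>\<^sub>M S \<Otimes>\<^sub>M A" by measurable
  have c: "(\<lambda>x. cond (fst x)) \<in> state_space N \<Otimes>\<^sub>M A \<rightarrow>\<^sub>M prob_algebra S"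
    by (rule measurable_compose[OF measurable_fst cond_kernel])
  have "(\<lambda>(x, z). transition M z (snd x)) \<in> (state_space N \<Otimes>\<^sub>M A) \<Otimes>\<^sub>M S \<rightarrow>\<^sub>M prob_algebra S"
    using measurable_compose[OF swap transition_measurable] by (simp add: case_prod_beta')
  from measurable_compose[OF measurable_bind_prob_space2[OF c this] measurable_distr_prob_space[OF Q_measurable']]
  have "(\<lambda>x. distr (cond (fst x) \<bind> (\<lambda>z. transition M z (snd x))) (state_space N) Q)
      \<in> state_space N \<Otimes>\<^sub>M A \<rightarrow>\<^sub>M prob_algebra (state_space N)" .
  also have "?this \<longleftrightarrow> (\<lambda>(z, a). transition N z a) \<in> state_space N \<Otimes>\<^sub>M A \<rightarrow>\<^sub>M prob_algebra (state_space N)"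
    by (rule measurable_cong) (auto simp: space_pair_measure transition_N)
  finally show "(\<lambda>(z, a). transition N z a) \<in> state_space N \<Otimes>\<^sub>M action_space N \<rightarrow>\<^sub>M prob_algebra (state_space N)"
    by simp
  have "(\<lambda>(x, z). cost M z (snd x)) \<in> borel_measurable ((state_space N \<Otimes>\<^sub>M A) \<Otimes>\<^sub>M S)"
    using measurable_compose[OF swap cost_measurable] by (simp add: case_prod_beta')
  from kernel_integral_measurable2[OF this c]
  have "(\<lambda>x. LINT z|cond (fst x). cost M z (snd x)) \<in> borel_measurable (state_space N \<Otimes>\<^sub>M A)" by simp
  also have "?this \<longleftrightarrow> (\<lambda>(z, a). cost N z a) \<in> borel_measurable (state_space N \<Otimes>\<^sub>M A)"
    by (rule measurable_cong) (auto simp: space_pair_measure cost_N)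
  finally show "(\<lambda>(z, a). cost N z a) \<in> borel_measurable (state_space N \<Otimes>\<^sub>M action_space N)"
    by simp
qed

sublocale N: bounded_mdp N B
proof
  show "is_mdp N" by (rule is_mdp_N)
  fix x a assume "x \<in> states N" "a \<in> actions N"
  then show "\<bar>cost N x a\<bar> \<le> B"
    using prob_algebra_integral_bound(2)[OF cond_prob_algebra cost_slice] cost_bound by (simp add: cost_N)
qed

text \<open>Rounding moves from the kernel onto the integrand: an update of \<open>u\<close> in the
  finite model is a cell average of updates of \<open>u \<circ> Q\<close> in the original model,
  where all comparisons can then take place.\<close>

lemma q_value_N:
  assumes x: "x \<in> Y" and a: "a \<in> actions M" and b: "\<And>y. y \<in> Y \<Longrightarrow> \<bar>u y\<bar> \<le> b"
  shows "cost N x a + \<beta> * (LINT y|transition N x a. u y) = (LINT z|cond x. q_value \<beta> (\<lambda>z. u (Q z)) z a)"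
proof -
  have u: "u \<in> borel_measurable (state_space N)" by (simp add: measurable_N)
  have uQ: "(\<lambda>z. u (Q z)) \<in> borel_measurable S" by (rule measurable_compose[OF Q_measurable' u])
  have uQb: "\<bar>u (Q z)\<bar> \<le> b" if "z \<in> space S" for z using that by (simp add: b Q_in)
  let ?p = "cond x \<bind> (\<lambda>z. transition M z a)"
  note c = cond_prob_algebra[OF x] and t = transition_slice[OF a]
  have sb: "sets ?p = sets S" by (rule sets_bind'[OF c t])
  have i: "(LINT y|transition N x a. u y) = (LINT z|cond x. LINT y|transition M z a. u (Q y))"
    unfolding transition_N[OF x a]
    by (subst integral_distr[OF _ u])
       (simp add: measurable_cong_sets[OF sb refl], rule integral_bind_prob_algebra[OF c t uQ uQb])
  have "integrable (cond x) (\<lambda>z. cost M z a)"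
    by (rule prob_algebra_integral_bound(1)[OF c cost_slice[OF a], of B]) (simp add: cost_bound a)
  moreover have "integrable (cond x) (\<lambda>z. LINT y|transition M z a. u (Q y))"
    by (rule prob_algebra_integral_bound(1)[OF c kernel_integral_measurable[OF t uQ], of b])
       (rule prob_algebra_integral_bound(2)[OF transition_prob_algebra uQ uQb], simp_all add: a)
  ultimately show ?thesis by (simp add: cost_N[OF x a] i q_value_def)
qed

lemma cond_integral_bounds:
  fixes \<phi> :: "'z \<Rightarrow> real"
  assumes x: "x \<in> Y" and \<phi>: "\<phi> \<in> borel_measurable S" and b: "\<And>y. y \<in> states M \<Longrightarrow> \<bar>\<phi> y\<bar> \<le> b"
  shows "(\<And>y. y \<in> cell (states M) Q x \<Longrightarrow> \<phi> y \<le> c) \<Longrightarrow> (LINT y|cond x. \<phi> y) \<le> c"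
    and "(\<And>y. y \<in> cell (states M) Q x \<Longrightarrow> c \<le> \<phi> y) \<Longrightarrow> c \<le> (LINT y|cond x. \<phi> y)"
proof -
  interpret c: prob_space "cond x" using cond_prob_algebra[OF x] by (simp add: space_prob_algebra)
  have i: "integrable (cond x) \<phi>"
    by (rule prob_algebra_integral_bound(1)[OF cond_prob_algebra[OF x] \<phi>, of b]) (simp add: b)
  show "(LINT y|cond x. \<phi> y) \<le> c" if "\<And>y. y \<in> cell (states M) Q x \<Longrightarrow> \<phi> y \<le> c"
    by (rule c.integral_le_const[OF i AE_mp[OF AE_cond[OF x] AE_I2]]) (simp add: that)
  show "c \<le> (LINT y|cond x. \<phi> y)" if "\<And>y. y \<in> cell (states M) Q x \<Longrightarrow> c \<le> \<phi> y"
    by (rule c.integral_ge_const[OF i AE_mp[OF AE_cond[OF x] AE_I2]]) (simp add: that)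
qed

lemma policy_evaluation_N:
  assumes f: "f \<in> state_space N \<rightarrow>\<^sub>M A" and \<beta>: "0 \<le> \<beta>" "\<beta> < 1"
  obtains u where "\<And>x. x \<in> Y \<Longrightarrow> \<bar>u x\<bar> \<le> B / (1 - \<beta>)"
    "\<And>x. x \<in> Y \<Longrightarrow> u x = (LINT z|cond x. q_value \<beta> (\<lambda>z. u (Q z)) z (f x))"
    "\<And>x. x \<in> Y \<Longrightarrow> discounted_cost N \<beta> (stationary_policy N f) x = u x"
proof -
  have f': "f \<in> state_space N \<rightarrow>\<^sub>M action_space N" using f by simp
  have fA: "f x \<in> actions M" if "x \<in> Y" for x using measurable_space[OF f, of x] that by simp
  show ?thesis
  proof (rule N.policy_evaluation[OF f' \<beta>])
    fix u
    assume u: "\<And>x. x \<in> states N \<Longrightarrow> \<bar>u x\<bar> \<le> B / (1 - \<beta>)"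
      "\<And>x. x \<in> states N \<Longrightarrow> u x = cost N x (f x) + \<beta> * (LINT y|transition N x (f x). u y)"
      "\<And>x. x \<in> states N \<Longrightarrow> discounted_cost N \<beta> (stationary_policy N f) x = u x"
    have b: "\<bar>u x\<bar> \<le> B / (1 - \<beta>)" if "x \<in> Y" for x using u(1)[of x] that by simp
    show thesis
    proof (rule that[OF b])
      show "u x = (LINT z|cond x. q_value \<beta> (\<lambda>z. u (Q z)) z (f x))" if x: "x \<in> Y" for x
        using u(2)[of x] q_value_N[OF x fA[OF x] b] x by simp
      show "discounted_cost N \<beta> (stationary_policy N f) x = u x" if "x \<in> Y" for x
        using u(3)[of x] that by simp
    qed
  qed
qed

end

section \<open>Lipschitz models\<close>

locale lipschitz_mdp = bounded_mdp M B
  for M :: "('z::polish_space, 'a::polish_space) mdp" and B +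
  fixes \<beta> K\<^sub>1 K\<^sub>2 :: real
  assumes \<beta>: "0 \<le> \<beta>" "\<beta> < 1"
    and compact_states: "compact (states M)"
    and actions_nonempty: "actions M \<noteq> {}"
    and K\<^sub>2: "0 \<le> K\<^sub>2" "\<beta> * K\<^sub>2 < 1"
    and c_lipschitz: "\<And>a. a \<in> actions M \<Longrightarrow> K\<^sub>1-lipschitz_on (states M) (\<lambda>z. cost M z a)"
    and p_lipschitz: "\<And>z y a. z \<in> states M \<Longrightarrow> y \<in> states M \<Longrightarrow> a \<in> actions M \<Longrightarrow>
      wasserstein1 (states M) (transition M z a) (transition M y a) \<le> ereal (K\<^sub>2 * dist z y)"
begin

text \<open>The solution of \<open>L = K\<^sub>1 + \<beta> * (L * K\<^sub>2)\<close>: the cost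
  contributes \<open>K\<^sub>1\<close>, and the transition multiplies the constant of the integrated
  function by \<open>K\<^sub>2\<close>.\<close>

definition L :: real where "L = K\<^sub>1 / (1 - \<beta> * K\<^sub>2)"

lemma K\<^sub>1_nonneg: "0 \<le> K\<^sub>1"
  using actions_nonempty c_lipschitz lipschitz_on_nonneg by blast

lemma L_nonneg: "0 \<le> L"
  using K\<^sub>1_nonneg K\<^sub>2 by (simp add: L_def)

lemma L_eq: "K\<^sub>1 + \<beta> * (L * K\<^sub>2) = L"
  using K\<^sub>2(2) by (simp add: L_def field_simps)

lemma lipschitz_measurable: "C-lipschitz_on (states M) v \<Longrightarrow> (v :: 'z \<Rightarrow> real) \<in> borel_measurable S"
  unfolding state_space_def
  by (intro borel_measurable_continuous_on_restrict lipschitz_on_continuous_on)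

lemma lipschitz_bounded:
  fixes v :: "'z \<Rightarrow> real"
  assumes "C-lipschitz_on (states M) v"
  obtains b where "\<And>z. z \<in> states M \<Longrightarrow> \<bar>v z\<bar> \<le> b"
proof -
  have "bounded (v ` states M)"
    by (intro compact_imp_bounded compact_continuous_image lipschitz_on_continuous_on[OF assms] compact_states)
  then show ?thesis using that by (auto simp: bounded_iff)
qed

lemma q_value_lipschitz:
  assumes v: "L-lipschitz_on (states M) v" and z: "z \<in> states M" "y \<in> states M" and a: "a \<in> actions M"
  shows "\<bar>q_value \<beta> v z a - q_value \<beta> v y a\<bar> \<le> L * dist z y"
proof -
  have "\<bar>cost M z a - cost M y a\<bar> \<le> K\<^sub>1 * dist z y"
    using lipschitz_onD[OF c_lipschitz[OF a] z] by (simp add: dist_real_def)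
  moreover have "\<bar>(LINT w|transition M z a. v w) - (LINT w|transition M y a. v w)\<bar> \<le> L * (K\<^sub>2 * dist z y)"
    by (rule wasserstein1_lipschitz_integral[OF v p_lipschitz[OF z a]])
       (use transition_prob_algebra z a in \<open>simp_all add: state_space_def\<close>)
  then have "\<bar>\<beta> * ((LINT w|transition M z a. v w) - (LINT w|transition M y a. v w))\<bar> \<le> \<beta> * (L * (K\<^sub>2 * dist z y))"
    using \<beta> by (simp add: abs_mult mult_left_mono)
  ultimately have "\<bar>q_value \<beta> v z a - q_value \<beta> v y a\<bar> \<le> K\<^sub>1 * dist z y + \<beta> * (L * (K\<^sub>2 * dist z y))"
    unfolding q_value_def right_diff_distrib by linarith
  also have "\<dots> = (K\<^sub>1 + \<beta> * (L * K\<^sub>2)) * dist z y" by (simp add: algebra_simps)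
  finally show ?thesis by (simp add: L_eq)
qed

text \<open>Stated one-sidedly and for bounded measurable functions, since it is applied to
  \<open>u \<circ> Q\<close>, which may jump at cell boundaries.\<close>

lemma q_value_diff:
  assumes v: "v \<in> borel_measurable S" "\<And>y. y \<in> states M \<Longrightarrow> \<bar>v y\<bar> \<le> b"
    and u: "u \<in> borel_measurable S" "\<And>y. y \<in> states M \<Longrightarrow> \<bar>u y\<bar> \<le> b'"
    and s: "\<And>y. y \<in> states M \<Longrightarrow> v y - u y \<le> s"
    and z: "z \<in> states M" and a: "a \<in> actions M"
  shows "q_value \<beta> v z a - q_value \<beta> u z a \<le> \<beta> * s"
proof -
  note t = transition_prob_algebra[OF z a]
  interpret t: prob_space "transition M z a" using t by (simp add: space_prob_algebra)
  have sp: "space (transition M z a) = states M"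
    using t by (auto simp: space_prob_algebra dest: sets_eq_imp_space_eq)
  have iv: "integrable (transition M z a) v"
    by (rule prob_algebra_integral_bound(1)[OF t v(1), of b]) (simp add: v(2))
  have iu: "integrable (transition M z a) u"
    by (rule prob_algebra_integral_bound(1)[OF t u(1), of b']) (simp add: u(2))
  have "(LINT y|transition M z a. v y - u y) \<le> s"
    by (rule t.integral_le_const) (use iv iu s sp in auto)
  then have "(LINT y|transition M z a. v y) - (LINT y|transition M z a. u y) \<le> s"
    using iv iu by simp
  then show ?thesis
    using \<beta> by (simp add: q_value_def right_diff_distrib[symmetric] mult_left_mono)
qed

lemma q_value_bdd_below:
  assumes v: "L-lipschitz_on (states M) v" and z: "z \<in> states M"
  shows "bdd_below (q_value \<beta> v z ` actions M)"
proof -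
  obtain b where b: "\<And>y. y \<in> states M \<Longrightarrow> \<bar>v y\<bar> \<le> b" using lipschitz_bounded[OF v] by blast
  have "- (B + \<beta> * b) \<le> q_value \<beta> v z a" if "a \<in> actions M" for a
    using q_value_bounded[OF that lipschitz_measurable[OF v] b \<beta>(1) z] by simp
  then show ?thesis by (rule bdd_belowI2)
qed

text \<open>An infimum of functions with a common Lipschitz constant keeps that constant, so the
  operator preserves the class; compactness of the state space supplies the bounds needed for
  contraction.\<close>

lemma bellman_fixed_point:
  obtains v where "L-lipschitz_on (states M) v"
    "\<And>z. z \<in> states M \<Longrightarrow> v z = (INF a\<in>actions M. q_value \<beta> v z a)"
proof -
  define T where "T v z = (INF a\<in>actions M. q_value \<beta> v z a)" for v z
  have "\<exists>v\<in>{v :: 'z \<Rightarrow> real. L-lipschitz_on (states M) v}. \<forall>z\<in>states M. T v z = v z"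
  proof (rule contraction_fixed_point[OF \<beta>])
    fix v assume "v \<in> {v :: 'z \<Rightarrow> real. L-lipschitz_on (states M) v}"
    then have v: "L-lipschitz_on (states M) v" by simp
    have "\<bar>T v z - T v y\<bar> \<le> L * dist z y" if "z \<in> states M" "y \<in> states M" for z y
      unfolding T_def
      by (rule cINF_diff_le[OF actions_nonempty q_value_bdd_below[OF v that(1)] q_value_bdd_below[OF v that(2)]
            q_value_lipschitz[OF v that]])
    then show "T v \<in> {v :: 'z \<Rightarrow> real. L-lipschitz_on (states M) v}"
      using L_nonneg by (auto intro!: lipschitz_onI simp: dist_real_def)
  next
    fix g h s z
    assume "g \<in> {v :: 'z \<Rightarrow> real. L-lipschitz_on (states M) v}" "h \<in> {v :: 'z \<Rightarrow> real. L-lipschitz_on (states M) v}"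
      and s: "\<And>y. y \<in> states M \<Longrightarrow> \<bar>g y - h y\<bar> \<le> s" and z: "z \<in> states M"
    then have g: "L-lipschitz_on (states M) g" and h: "L-lipschitz_on (states M) h" by auto
    obtain b where b: "\<And>y. y \<in> states M \<Longrightarrow> \<bar>g y\<bar> \<le> b" using lipschitz_bounded[OF g] by blast
    obtain b' where b': "\<And>y. y \<in> states M \<Longrightarrow> \<bar>h y\<bar> \<le> b'" using lipschitz_bounded[OF h] by blast
    note g' = lipschitz_measurable[OF g] and h' = lipschitz_measurable[OF h]
    show "\<bar>T g z - T h z\<bar> \<le> \<beta> * s"
      unfolding T_def
    proof (rule cINF_diff_le[OF actions_nonempty q_value_bdd_below[OF g z] q_value_bdd_below[OF h z]])
      fix a assume a: "a \<in> actions M"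
      have "q_value \<beta> g z a - q_value \<beta> h z a \<le> \<beta> * s"
        by (rule q_value_diff[OF g' b h' b' _ z a]) (use s in \<open>auto simp: abs_le_iff\<close>)
      moreover have "q_value \<beta> h z a - q_value \<beta> g z a \<le> \<beta> * s"
        by (rule q_value_diff[OF h' b' g' b _ z a]) (use s in \<open>auto simp: abs_le_iff\<close>)
      ultimately show "\<bar>q_value \<beta> g z a - q_value \<beta> h z a\<bar> \<le> \<beta> * s" by simp
    qed
  next
    fix w g
    assume w: "\<And>k. w k \<in> {v :: 'z \<Rightarrow> real. L-lipschitz_on (states M) v}"
      and lim: "\<And>z. z \<in> states M \<Longrightarrow> (\<lambda>k. w k z) \<longlonglongrightarrow> g z"
    have "dist (g z) (g y) \<le> L * dist z y" if zy: "z \<in> states M" "y \<in> states M" for z y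
    proof (rule LIMSEQ_le_const2[OF tendsto_dist[OF lim[OF zy(1)] lim[OF zy(2)]]])
      show "\<exists>N. \<forall>k\<ge>N. dist (w k z) (w k y) \<le> L * dist z y"
        using w zy by (auto intro: lipschitz_onD)
    qed
    then show "g \<in> {v :: 'z \<Rightarrow> real. L-lipschitz_on (states M) v}"
      using L_nonneg by (auto intro!: lipschitz_onI)
  next
    show "(\<lambda>_. 0) \<in> {v :: 'z \<Rightarrow> real. L-lipschitz_on (states M) v}"
      using L_nonneg by (auto intro!: lipschitz_onI)
    fix z assume z: "z \<in> states M"
    \<comment> \<open>Zero is written as an infimum so that \<open>cINF_diff_le\<close> bounds the
      first increment.\<close>
    have "\<bar>T (\<lambda>_. 0) z - (INF a\<in>actions M. 0)\<bar> \<le> B"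
      unfolding T_def
    proof (rule cINF_diff_le[OF actions_nonempty])
      show "bdd_below (q_value \<beta> (\<lambda>_. 0) z ` actions M)"
        by (rule q_value_bdd_below[OF _ z]) (use L_nonneg in \<open>auto intro!: lipschitz_onI\<close>)
      show "\<bar>q_value \<beta> (\<lambda>_. 0) z a - 0\<bar> \<le> B" if "a \<in> actions M" for a
        using cost_bound[OF z that] by (simp add: q_value_def)
    qed auto
    then show "\<bar>T (\<lambda>_. 0) z - 0\<bar> \<le> B" using actions_nonempty by simp
  qed
  then obtain v where "L-lipschitz_on (states M) v" "\<And>z. z \<in> states M \<Longrightarrow> T v z = v z"
    by blast
  then show ?thesis by (intro that[of v]) (simp_all add: T_def)
qed

end

section \<open>Error of the policy extended from the finite model\<close>

locale lipschitz_approximation =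
  lipschitz_mdp M B \<beta> K\<^sub>1 K\<^sub>2 + finite_approximation M B Y Q \<nu>
  for M :: "('z::polish_space, 'a::polish_space) mdp" and B \<beta> K\<^sub>1 K\<^sub>2 Y Q \<nu> +
  fixes \<epsilon> :: real
  assumes Q_close: "\<And>z. z \<in> states M \<Longrightarrow> dist z (Q z) \<le> \<epsilon>"
begin

lemma cell_close:
  assumes "z \<in> states M" "y \<in> cell (states M) Q (Q z)"
  shows "y \<in> states M" "dist z y \<le> 2 * \<epsilon>"
proof -
  show y: "y \<in> states M" using assms by (simp add: cell_def)
  have "dist z y \<le> dist z (Q z) + dist y (Q z)" by (rule dist_triangle2)
  then show "dist z y \<le> 2 * \<epsilon>"
    using Q_close[OF assms(1)] Q_close[OF y] assms by (simp add: cell_def)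
qed

lemma approximate_policy_bound:
  assumes opt: "optimal_stationary N \<beta> f" and z: "z \<in> states M"
  shows "\<bar>discounted_cost M \<beta> (stationary_policy M (f \<circ> Q)) z - value_function M \<beta> z\<bar>
    \<le> 4 * L * \<epsilon> / (1 - \<beta>)\<^sup>2"
proof -
  obtain v where v: "L-lipschitz_on (states M) v"
    and vT: "\<And>z. z \<in> states M \<Longrightarrow> v z = (INF a\<in>actions M. q_value \<beta> v z a)"
    using bellman_fixed_point by blast
  note vm = lipschitz_measurable[OF v]
  obtain b where vb: "\<And>y. y \<in> states M \<Longrightarrow> \<bar>v y\<bar> \<le> b" using lipschitz_bounded[OF v] by blast
  have v_le: "v z \<le> q_value \<beta> v z a" if "z \<in> states M" "a \<in> actions M" for z a
    using cINF_lower[OF q_value_bdd_below[OF v that(1)] that(2)] vT[OF that(1)] by simp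
  have v_lip: "v z \<le> v y + L * dist z y" if "z \<in> states M" "y \<in> states M" for z y
    using lipschitz_onD[OF v that] by (simp add: dist_real_def)
  \<comment> \<open>The uniform gap between \<open>v\<close> and \<open>u \<circ> Q\<close>: an
    error \<open>2 * \<epsilon> * L\<close> per update, absorbed through
    \<open>2 * \<epsilon> * L + \<beta> * r = r\<close>.\<close>
  define r where "r = 2 * \<epsilon> * L / (1 - \<beta>)"
  have r: "2 * \<epsilon> * L + \<beta> * r = r" using \<beta> by (simp add: r_def field_simps)

  have f: "f \<in> state_space N \<rightarrow>\<^sub>M A" and f_pol: "stationary_policy N f \<in> policies N"
    and f_opt: "\<And>x. x \<in> Y \<Longrightarrow> discounted_cost N \<beta> (stationary_policy N f) x = value_function N \<beta> x"
    using opt by (auto simp: optimal_stationary_def optimal_policy_def)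
  have fA: "f x \<in> actions M" if "x \<in> Y" for x using measurable_space[OF f, of x] that by simp
  obtain u where u: "\<And>x. x \<in> Y \<Longrightarrow> \<bar>u x\<bar> \<le> B / (1 - \<beta>)"
    "\<And>x. x \<in> Y \<Longrightarrow> u x = (LINT z|cond x. q_value \<beta> (\<lambda>z. u (Q z)) z (f x))"
    "\<And>x. x \<in> Y \<Longrightarrow> discounted_cost N \<beta> (stationary_policy N f) x = u x"
    using policy_evaluation_N[OF f \<beta>] by blast
  have comp: "(\<lambda>z. w (Q z)) \<in> borel_measurable S" for w :: "'z \<Rightarrow> real"
    by (rule measurable_compose[OF Q_measurable']) (simp add: measurable_N)
  have um: "(\<lambda>z. u (Q z)) \<in> borel_measurable S" by (rule comp)
  have ub: "\<bar>u (Q y)\<bar> \<le> B / (1 - \<beta>)" if "y \<in> states M" for y using u(1) Q_in[OF that] by simp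

  \<comment> \<open>Rests on \<open>v\<close> being at most each of its q-values; the error is the
    move of \<open>v\<close> from \<open>z\<close> to another point of the same cell, at distance at
    most \<open>2 * \<epsilon>\<close>.\<close>
  have lower: "v z - u (Q z) \<le> r" if "z \<in> states M" for z
    unfolding r_def
  proof (rule contraction_upper_bound[OF \<beta>, where Z = "states M" and b = "b + B / (1 - \<beta>)" and h = "\<lambda>z. v z - u (Q z)"])
    show "v z - u (Q z) \<le> b + B / (1 - \<beta>)" if "z \<in> states M" for z
      using vb[OF that] ub[OF that] by linarith
  next
    fix s z assume s: "\<And>y. y \<in> states M \<Longrightarrow> v y - u (Q y) \<le> s" and z: "z \<in> states M"
    have "v z - 2 * \<epsilon> * L - \<beta> * s \<le> (LINT y|cond (Q z). q_value \<beta> (\<lambda>z. u (Q z)) y (f (Q z)))"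
    proof (rule cond_integral_bounds(2)[OF Q_in[OF z]
          q_value_measurable[OF fA[OF Q_in[OF z]] um] q_value_bounded[where v = "\<lambda>z. u (Q z)", OF fA[OF Q_in[OF z]] um ub \<beta>(1)]])
      fix y assume y: "y \<in> cell (states M) Q (Q z)"
      note yz = cell_close[OF z y]
      have "L * dist z y \<le> L * (2 * \<epsilon>)" using yz(2) L_nonneg by (rule mult_left_mono)
      moreover have "q_value \<beta> v y (f (Q z)) - q_value \<beta> (\<lambda>z. u (Q z)) y (f (Q z)) \<le> \<beta> * s"
        by (rule q_value_diff[OF vm vb um ub s yz(1) fA[OF Q_in[OF z]]])
      ultimately show "v z - 2 * \<epsilon> * L - \<beta> * s \<le> q_value \<beta> (\<lambda>z. u (Q z)) y (f (Q z))"
        using v_lip[OF z yz(1)] v_le[OF yz(1) fA[OF Q_in[OF z]]] by (simp add: algebra_simps)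
    qed
    then show "v z - u (Q z) \<le> 2 * \<epsilon> * L + \<beta> * s" using u(2)[OF Q_in[OF z]] by simp
  qed (rule that)

  \<comment> \<open>The locale does not provide minimizing actions, so \<open>g\<close> is
    \<open>\<delta>\<close>-optimal for \<open>v\<close> at the finitely many representatives; its
    cost \<open>w\<close> in the finite model lies above \<open>u\<close>.\<close>
  have upper_\<delta>: "u (Q z) - v z \<le> (2 * \<epsilon> * L + \<delta>) / (1 - \<beta>)" if \<delta>: "0 < \<delta>" and z: "z \<in> states M" for \<delta> z
  proof -
    have "\<exists>a\<in>actions M. q_value \<beta> v x a < v x + \<delta>" if "x \<in> Y" for x
    proof -
      have "x \<in> states M" using that Y by auto
      then show ?thesis
        using cINF_less_iff[OF actions_nonempty q_value_bdd_below[OF v], of x "v x + \<delta>"] vT[of x] \<delta> by simp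
    qed
    then obtain g where g: "\<And>x. x \<in> Y \<Longrightarrow> g x \<in> actions M" "\<And>x. x \<in> Y \<Longrightarrow> q_value \<beta> v x (g x) < v x + \<delta>"
      by metis
    have gm: "g \<in> state_space N \<rightarrow>\<^sub>M A" using g(1) by (simp add: measurable_N)
    obtain w where w: "\<And>x. x \<in> Y \<Longrightarrow> \<bar>w x\<bar> \<le> B / (1 - \<beta>)"
      "\<And>x. x \<in> Y \<Longrightarrow> w x = (LINT z|cond x. q_value \<beta> (\<lambda>z. w (Q z)) z (g x))"
      "\<And>x. x \<in> Y \<Longrightarrow> discounted_cost N \<beta> (stationary_policy N g) x = w x"
      using policy_evaluation_N[OF gm \<beta>] by blast
    have wm: "(\<lambda>z. w (Q z)) \<in> borel_measurable S" by (rule comp)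
    have wb: "\<bar>w (Q y)\<bar> \<le> B / (1 - \<beta>)" if "y \<in> states M" for y using w(1) Q_in[OF that] by simp
    have "w (Q z) - v z \<le> (2 * \<epsilon> * L + \<delta>) / (1 - \<beta>)"
    proof (rule contraction_upper_bound[OF \<beta>, where Z = "states M" and b = "b + B / (1 - \<beta>)" and h = "\<lambda>z. w (Q z) - v z"])
      show "w (Q z) - v z \<le> b + B / (1 - \<beta>)" if "z \<in> states M" for z
        using vb[OF that] wb[OF that] by linarith
    next
      fix s z assume s: "\<And>y. y \<in> states M \<Longrightarrow> w (Q y) - v y \<le> s" and z: "z \<in> states M"
      note x = Q_in[OF z]
      have xM: "Q z \<in> states M" using x Y by auto
      have "(LINT y|cond (Q z). q_value \<beta> (\<lambda>z. w (Q z)) y (g (Q z))) \<le> v z + (2 * \<epsilon> * L + \<delta> + \<beta> * s)"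
      proof (rule cond_integral_bounds(1)[OF x
            q_value_measurable[OF g(1)[OF x] wm] q_value_bounded[where v = "\<lambda>z. w (Q z)", OF g(1)[OF x] wm wb \<beta>(1)]])
        fix y assume y: "y \<in> cell (states M) Q (Q z)"
        note yz = cell_close[OF z y]
        \<comment> \<open>\<open>g\<close> is nearly optimal only at the representative. The
          estimate travels from \<open>y\<close> to \<open>Q z\<close> through q-values of
          \<open>v\<close> and from \<open>Q z\<close> to \<open>z\<close> through \<open>v\<close>;
          each leg costs \<open>L * \<epsilon>\<close>.\<close>
        have "dist y (Q z) \<le> \<epsilon>" using Q_close[OF yz(1)] y by (simp add: cell_def)
        then have "L * dist y (Q z) \<le> L * \<epsilon>" using L_nonneg by (rule mult_left_mono)
        moreover have "L * dist (Q z) z \<le> L * \<epsilon>"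
          using mult_left_mono[OF Q_close[OF z] L_nonneg] by (simp add: dist_commute)
        moreover have "q_value \<beta> (\<lambda>z. w (Q z)) y (g (Q z)) - q_value \<beta> v y (g (Q z)) \<le> \<beta> * s"
          by (rule q_value_diff[OF wm wb vm vb s yz(1) g(1)[OF x]])
        moreover have "q_value \<beta> v y (g (Q z)) - q_value \<beta> v (Q z) (g (Q z)) \<le> L * dist y (Q z)"
          using q_value_lipschitz[OF v yz(1) xM g(1)[OF x]] by simp
        ultimately show "q_value \<beta> (\<lambda>z. w (Q z)) y (g (Q z)) \<le> v z + (2 * \<epsilon> * L + \<delta> + \<beta> * s)"
          using g(2)[OF x] v_lip[OF xM z] by (simp add: algebra_simps)
      qed
      then show "w (Q z) - v z \<le> 2 * \<epsilon> * L + \<delta> + \<beta> * s" using w(2)[OF x] by simp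
    qed (rule z)
    \<comment> \<open>Optimality of \<open>f\<close> in the finite model enters here.\<close>
    moreover have "u (Q z) \<le> w (Q z)"
    proof -
      have "value_function N \<beta> (Q z) \<le> discounted_cost N \<beta> (stationary_policy N g) (Q z)"
        using Q_in[OF z] gm by (intro N.value_function_le N.stationary_policy_in_policies \<beta>) simp_all
      then show ?thesis using f_opt u(3) w(3) Q_in[OF z] by simp
    qed
    ultimately show ?thesis by simp
  qed
  have upper: "u (Q z) - v z \<le> r" if z: "z \<in> states M" for z
  proof (rule field_le_epsilon)
    fix e :: real assume e: "0 < e"
    \<comment> \<open>The choice \<open>\<delta> = e * (1 - \<beta>)\<close> leaves exactly
      \<open>e\<close> after the division.\<close>
    have "u (Q z) - v z \<le> (2 * \<epsilon> * L + e * (1 - \<beta>)) / (1 - \<beta>)"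
      by (rule upper_\<delta>[OF _ z]) (use e \<beta> in simp)
    then show "u (Q z) - v z \<le> r + e" using \<beta> by (simp add: r_def add_divide_distrib)
  qed

  have fQ: "f \<circ> Q \<in> S \<rightarrow>\<^sub>M A" by (rule measurable_comp[OF Q_measurable' f])
  note pol = stationary_policy_in_policies[OF fQ]
  \<comment> \<open>The loss per step: moving within the cell costs
    \<open>2 * \<epsilon> * L\<close>, replacing \<open>v\<close> by \<open>u \<circ> Q\<close>
    under the transition \<open>\<beta> * r\<close>, returning from \<open>u (Q z)\<close> to
    \<open>v z\<close> another \<open>r\<close>. By the equation for \<open>r\<close> the total is
    \<open>2 * r\<close>.\<close>
  have "1 * discounted_cost M \<beta> (stationary_policy M (f \<circ> Q)) z \<le> 1 * v z + 2 * r / (1 - \<beta>)"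
  proof (rule verification_stationary[OF fQ z \<beta> vm vb])
    fix z assume z: "z \<in> states M"
    note x = Q_in[OF z]
    have "q_value \<beta> v z (f (Q z)) - 2 * \<epsilon> * L - \<beta> * r \<le> (LINT y|cond (Q z). q_value \<beta> (\<lambda>z. u (Q z)) y (f (Q z)))"
    proof (rule cond_integral_bounds(2)[OF x q_value_measurable[OF fA[OF x] um] q_value_bounded[where v = "\<lambda>z. u (Q z)", OF fA[OF x] um ub \<beta>(1)]])
      fix y assume y: "y \<in> cell (states M) Q (Q z)"
      note yz = cell_close[OF z y]
      have "L * dist z y \<le> L * (2 * \<epsilon>)" using yz(2) L_nonneg by (rule mult_left_mono)
      moreover have "q_value \<beta> v y (f (Q z)) - q_value \<beta> (\<lambda>z. u (Q z)) y (f (Q z)) \<le> \<beta> * r"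
        by (rule q_value_diff[OF vm vb um ub lower yz(1) fA[OF x]])
      ultimately show "q_value \<beta> v z (f (Q z)) - 2 * \<epsilon> * L - \<beta> * r \<le> q_value \<beta> (\<lambda>z. u (Q z)) y (f (Q z))"
        using q_value_lipschitz[OF v z yz(1) fA[OF x]] by (simp add: algebra_simps abs_le_iff)
    qed
    then have "q_value \<beta> v z (f (Q z)) \<le> v z + 2 * r"
      using u(2)[OF x] upper[OF z] r by simp
    then show "1 * (cost M z ((f \<circ> Q) z) + \<beta> * (LINT y|transition M z ((f \<circ> Q) z). v y) - v z) \<le> 2 * r"
      by (simp add: q_value_def)
  qed
  moreover have "v z \<le> value_function M \<beta> z"
    unfolding value_function_def
  proof (rule cINF_greatest)
    show "policies M \<noteq> {}" using pol by blast
    fix \<pi> assume pi: "\<pi> \<in> policies M"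
    show "v z \<le> discounted_cost M \<beta> \<pi> z"
      by (rule verification_lower[OF pi z \<beta> vm vb]) (use v_le in \<open>auto simp: q_value_def\<close>)
  qed
  moreover have "value_function M \<beta> z \<le> discounted_cost M \<beta> (stationary_policy M (f \<circ> Q)) z"
    by (rule value_function_le[OF pol z \<beta>])
  moreover have "2 * r / (1 - \<beta>) = 4 * L * \<epsilon> / (1 - \<beta>)\<^sup>2"
    by (simp add: r_def power2_eq_square)
  ultimately show ?thesis by simp
qed

end

text \<open>The derived bound has \<open>2 / (1 - \<beta>)\<close> where the claim has
  \<open>tau\<close>. Over the common denominator this compares \<open>2 - 2 * \<beta>\<close> with
  \<open>\<beta>\<^sup>2 + 4 * \<beta> + 2\<close>; the summand with \<open>K\<close> is
  nonnegative.\<close>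

lemma tau_ge:
  assumes "0 < \<beta>" "\<beta> < 1" "0 \<le> K"
  shows "2 / (1 - \<beta>) \<le> tau \<beta> K"
proof -
  have "2 / (1 - \<beta>) = 2 * (1 - \<beta>) / (1 - \<beta>)\<^sup>2"
    unfolding power2_eq_square
    by (rule nonzero_mult_divide_mult_cancel_right[symmetric]) (use assms in simp)
  also have "\<dots> \<le> (\<beta>\<^sup>2 + 4 * \<beta> + 2) / (1 - \<beta>)\<^sup>2"
    using assms by (intro divide_right_mono) auto
  also have "\<dots> \<le> tau \<beta> K" using assms by (simp add: tau_def)
  finally show ?thesis .
qed

text \<open>With the sup norm in the extended reals, the bound includes finiteness and reduces to a
  pointwise estimate.\<close>

theorem theorem5p2:
  fixes M :: "(real ^ 'd, 'a::polish_space) mdp"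
    and \<beta> K\<^sub>1 K\<^sub>2 \<alpha> :: real
    and Zn :: "nat \<Rightarrow> (real ^ 'd) set"
    and Q :: "nat \<Rightarrow> real ^ 'd \<Rightarrow> real ^ 'd"
    and \<nu> :: "nat \<Rightarrow> (real ^ 'd) measure"
    and f :: "nat \<Rightarrow> real ^ 'd \<Rightarrow> 'a"
  assumes beta: "0 < \<beta>" "\<beta> < 1"
    and mdp: "is_mdp M"
    and A_compact: "compact (actions M)"
    and Z_compact: "compact (states M)" "infinite (states M)"
    and c_bounded: "bounded ((\<lambda>(z, a). cost M z a) ` (states M \<times> actions M))"
    and c_continuous: "continuous_on (states M \<times> actions M) (\<lambda>(z, a). cost M z a)"
    and p_continuous: "weakly_continuous_kernel M"
    and c_lipschitz: "\<And>a. a \<in> actions M \<Longrightarrow> K\<^sub>1-lipschitz_on (states M) (\<lambda>z. cost M z a)"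
    and p_lipschitz: "\<And>z y a. z \<in> states M \<Longrightarrow> y \<in> states M \<Longrightarrow> a \<in> actions M \<Longrightarrow>
      wasserstein1 (states M) (transition M z a) (transition M y a) \<le> ereal (K\<^sub>2 * dist z y)"
    and contraction: "K\<^sub>2 * \<beta> < 1"
    and alpha: "0 < \<alpha>"
    and Zn: "\<And>n. 1 \<le> n \<Longrightarrow> Zn n \<subseteq> states M"
      "\<And>n. 1 \<le> n \<Longrightarrow> finite (Zn n)"
      "\<And>n. 1 \<le> n \<Longrightarrow> card (Zn n) = n"
      "\<And>n. 1 \<le> n \<Longrightarrow>
        (SUP z\<in>states M. Min (dist z ` Zn n)) \<le> \<alpha> * (1 / real n) powr (1 / real CARD('d))"
    and Q: "\<And>n. 1 \<le> n \<Longrightarrow> nearest_neighbour_map (states M) (Zn n) (Q n)"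
    and nu: "\<And>n. 1 \<le> n \<Longrightarrow> \<nu> n \<in> space (prob_algebra (state_space M))"
      "\<And>n x. 1 \<le> n \<Longrightarrow> x \<in> Zn n \<Longrightarrow> measure (\<nu> n) (cell (states M) (Q n) x) > 0"
    and f_optimal: "\<And>n. 1 \<le> n \<Longrightarrow>
      optimal_stationary (finite_model M (Zn n) (Q n) (\<nu> n)) \<beta> (f n)"
  shows "\<forall>n\<ge>1.
    (SUP z\<in>states M. ereal \<bar>discounted_cost M \<beta> (stationary_policy M (f n \<circ> Q n)) z
        - value_function M \<beta> z\<bar>)
    \<le> ereal ((tau \<beta> K\<^sub>2 * K\<^sub>1 * (1 / (1 - \<beta> * K\<^sub>2)) + 2 * K\<^sub>1 / (1 - \<beta>)) / (1 - \<beta>)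
        * (2 * \<alpha> * (1 / real n) powr (1 / real CARD('d))))"
proof (intro allI impI SUP_least)
  fix n :: nat and z :: "real ^ 'd"
  assume n: "1 \<le> n" and z: "z \<in> states M"
  let ?N = "finite_model M (Zn n) (Q n) (\<nu> n)"
  define \<epsilon> where "\<epsilon> = \<alpha> * (1 / real n) powr (1 / real CARD('d))"
  obtain B where B: "\<And>z a. z \<in> states M \<Longrightarrow> a \<in> actions M \<Longrightarrow> \<bar>cost M z a\<bar> \<le> B"
    using c_bounded unfolding bounded_iff by fastforce
  have Y_ne: "Zn n \<noteq> {}" using Zn(3)[OF n] n by auto
  have near: "is_arg_min (dist y) (\<lambda>x. x \<in> Zn n) (Q n y)" if "y \<in> states M" for y
    using Q[OF n] that by (simp add: nearest_neighbour_map_def)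
  \<comment> \<open>The value of the optimal policy at the representative of \<open>z\<close>
    witnesses that the action set is nonempty.\<close>
  have "f n (Q n z) \<in> space (action_space ?N)"
    using f_optimal[OF n] near[OF z] unfolding optimal_stationary_def
    by (elim conjE measurable_space)
       (simp add: is_arg_min_def finite_model_def state_space_def space_restrict_space)
  then have A_ne: "actions M \<noteq> {}"
    by (auto simp: finite_model_def action_space_def space_restrict_space)
  \<comment> \<open>An infinite state space has two distinct points, and the zero test function
    shows that the Wasserstein distance is nonnegative.\<close>
  have K2: "0 \<le> K\<^sub>2"
  proof -
    from Z_compact(2) have "\<not> states M \<subseteq> {z}" using finite_subset by blast
    then obtain y where y: "y \<in> states M" "y \<noteq> z" by blast
    obtain a where a: "a \<in> actions M" using A_ne by blast
    have "ereal \<bar>(LINT w|transition M z a. 0) - (LINT w|transition M y a. 0)\<bar>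
        \<le> wasserstein1 (states M) (transition M z a) (transition M y a)"
      unfolding wasserstein1_def by (rule SUP_upper) (auto intro: lipschitz_onI)
    also have "\<dots> \<le> ereal (K\<^sub>2 * dist z y)" by (rule p_lipschitz[OF z y(1) a])
    finally show ?thesis using y(2) by (simp add: zero_le_mult_iff)
  qed
  have close: "dist y (Q n y) \<le> \<epsilon>" if y: "y \<in> states M" for y
  proof -
    have "dist y (Q n y) \<le> Min (dist y ` Zn n)"
      using near[OF y] Y_ne Zn(2)[OF n] by (auto simp: is_arg_min_linorder)
    \<comment> \<open>A real supremum dominates its family only if that family is bounded above; the
      diameter of the compact state space is a bound.\<close>
    also have "\<dots> \<le> (SUP z\<in>states M. Min (dist z ` Zn n))"
    proof (rule cSUP_upper[OF y])
      obtain x where x: "x \<in> Zn n" using Y_ne by blast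
      have "Min (dist w ` Zn n) \<le> diameter (states M)" if w: "w \<in> states M" for w
      proof -
        have "Min (dist w ` Zn n) \<le> dist w x" using x Zn(2)[OF n] by simp
        also have "\<dots> \<le> diameter (states M)"
          using x Zn(1)[OF n] w by (intro diameter_bounded_bound compact_imp_bounded Z_compact) auto
        finally show ?thesis .
      qed
      then show "bdd_above ((\<lambda>z. Min (dist z ` Zn n)) ` states M)" by (rule bdd_aboveI2)
    qed
    also have "\<dots> \<le> \<epsilon>" unfolding \<epsilon>_def by (rule Zn(4)[OF n])
    finally show ?thesis .
  qed
  interpret lipschitz_approximation M B \<beta> K\<^sub>1 K\<^sub>2 "Zn n" "Q n" "\<nu> n" \<epsilon>
  proof unfold_locales
    show "\<beta> * K\<^sub>2 < 1" using contraction by (simp add: mult.commute)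
    show "Q n \<in> restrict_space borel (states M) \<rightarrow>\<^sub>M restrict_space borel (Zn n)"
      using Q[OF n] by (simp add: nearest_neighbour_map_def)
  qed (fact mdp B less_imp_le[OF beta(1)] beta(2) Z_compact(1) A_ne K2 c_lipschitz p_lipschitz
      Zn(1)[OF n] Zn(2)[OF n] nu(1)[OF n] nu(2)[OF n] close)+
  have \<epsilon>: "0 \<le> \<epsilon>" using alpha by (simp add: \<epsilon>_def)
  have "\<bar>discounted_cost M \<beta> (stationary_policy M (f n \<circ> Q n)) z - value_function M \<beta> z\<bar>
      \<le> 4 * L * \<epsilon> / (1 - \<beta>)\<^sup>2"
    by (rule approximate_policy_bound[OF f_optimal[OF n] z])
  \<comment> \<open>Regrouped to the shape of the claim, which leaves
    \<open>2 / (1 - \<beta>)\<close> to be dominated by \<open>tau\<close>.\<close>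
  also have "\<dots> = 2 / (1 - \<beta>) * L / (1 - \<beta>) * (2 * \<epsilon>)"
    by (simp add: power2_eq_square)
  also have "\<dots> \<le> (tau \<beta> K\<^sub>2 * L + 2 * K\<^sub>1 / (1 - \<beta>)) / (1 - \<beta>) * (2 * \<epsilon>)"
  proof (intro mult_right_mono divide_right_mono)
    have "2 / (1 - \<beta>) * L \<le> tau \<beta> K\<^sub>2 * L"
      by (rule mult_right_mono[OF tau_ge[OF beta K2] L_nonneg])
    moreover have "0 \<le> 2 * K\<^sub>1 / (1 - \<beta>)" using K\<^sub>1_nonneg beta by simp
    ultimately show "2 / (1 - \<beta>) * L \<le> tau \<beta> K\<^sub>2 * L + 2 * K\<^sub>1 / (1 - \<beta>)" by linarith
  qed (use \<epsilon> beta in auto)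
  finally show "ereal \<bar>discounted_cost M \<beta> (stationary_policy M (f n \<circ> Q n)) z - value_function M \<beta> z\<bar>
    \<le> ereal ((tau \<beta> K\<^sub>2 * K\<^sub>1 * (1 / (1 - \<beta> * K\<^sub>2)) + 2 * K\<^sub>1 / (1 - \<beta>)) / (1 - \<beta>)
        * (2 * \<alpha> * (1 / real n) powr (1 / real CARD('d))))"
    by (simp add: L_def \<epsilon>_def mult.assoc)
qed

end
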